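(* There does not exist a strongly regular graph with parameters $(1911,270,105,27)$.
   Context: A strongly regular graph with parameters $(n,k,\lambda,\mu)$ is a finite simple graph on $n$ vertices that is $k$-regular, in which any two distinct adjacent vertices have exactly $\lambda$ common neighbours and any two distinct non-adjacent vertices have exactly $\mu$ common neighbours. *)

theory Defs
  imports "Graph_Theory.Pair_Digraph"
begin

text \<open>
  A finite simple graph is a \<open>pair_graph\<close>: a finite vertex set together with a symmetric,
  irreflexive set of ordered pairs of vertices. Every edge \<open>{u, v}\<close> is present as the two arcs
  \<open>(u, v)\<close> and \<open>(v, u)\<close>, so the out-degree of a vertex is its number of neighbours.
\<close>

definition common_neighbours :: "'a pair_pre_digraph \<Rightarrow> 'a \<Rightarrow> 'a \<Rightarrow> 'a set" where
  "common_neighbours G u v = {w \<in> pverts G. (u, w) \<in> parcs G \<and> (v, w) \<in> parcs G}"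

locale strongly_regular_graph = pair_graph G
  for G :: "'a pair_pre_digraph" +
  fixes n k l m :: nat
  assumes card_verts: "card (pverts G) = n"
    and regular: "\<And>v. v \<in> pverts G \<Longrightarrow> out_degree (with_proj G) v = k"
    and adjacent: "\<And>u v. \<lbrakk>u \<in> pverts G; v \<in> pverts G; u \<noteq> v; (u, v) \<in> parcs G\<rbrakk>
      \<Longrightarrow> card (common_neighbours G u v) = l"
    and non_adjacent: "\<And>u v. \<lbrakk>u \<in> pverts G; v \<in> pverts G; u \<noteq> v; (u, v) \<notin> parcs G\<rbrakk>
      \<Longrightarrow> card (common_neighbours G u v) = m"

end

theory Submission
  imports Defs Complex_Main
begin

text \<open>
  The adjacency matrix \<open>A\<close> has smallest eigenvalue \<open>-3\<close>, and \<open>A + 3 I - J / 7\<close> is positive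
  semidefinite. Hence a vertex outside a large clique \<open>C\<close> is adjacent to either few or almost all
  vertices of \<open>C\<close>, while two non-adjacent vertices have only 27 common neighbours. Counting edges
  leaving \<open>C\<close> produces many vertices that miss at most six vertices of \<open>C\<close>; they contain a large
  clique, which merges with most of \<open>C\<close> into a larger one. This bounds all cliques by 28 vertices.

  On the other hand, let \<open>K\<close> be a maximum coclique in the neighbourhood of a vertex. If \<open>K\<close> has at
  most 4 elements, then a member of \<open>K\<close> with its private neighbours yields a clique of 29 vertices.
  If it has 5 elements, then all counting estimates are tight. For \<open>a, b \<in> K\<close>, the 30 vertices of
  the neighbourhood without neighbours in \<open>K - {a, b}\<close> then form a graph whose complement is 2-regular
  up to isolated vertices, and nearly every common neighbour of \<open>a\<close> and a third \<open>c \<in> K\<close> is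
  adjacent to exactly one end of each edge of that complement. By semidefiniteness the complement
  has few isolated vertices, and two such common neighbours cannot agree on the 30 vertices; but two
  with a common non-neighbour among the common neighbours of \<open>a\<close> and \<open>c\<close> do agree.
\<close>

section \<open>The graph as a symmetric relation, and edge counting\<close>

locale srg1911 =
  fixes V :: "'a set" and E :: "'a \<Rightarrow> 'a \<Rightarrow> bool"
  assumes finV: "finite V"
    and cardV: "card V = 1911"
    and sym: "E u v \<Longrightarrow> E v u"
    and irrefl: "\<not> E u u"
    and inV: "E u v \<Longrightarrow> v \<in> V"
    and deg: "v \<in> V \<Longrightarrow> card {w. E v w} = 270"
    and lam: "E u v \<Longrightarrow> card ({w. E u w} \<inter> {w. E v w}) = 105"
    and mu: "\<lbrakk>u \<in> V; v \<in> V; u \<noteq> v; \<not> E u v\<rbrakk> \<Longrightarrow> card ({w. E u w} \<inter> {w. E v w}) = 27"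
begin

definition N :: "'a \<Rightarrow> 'a set" where "N u = {w. E u w}"

lemma in_N [simp]: "w \<in> N u \<longleftrightarrow> E u w"
  by (simp add: N_def)

lemma N_subset: "N u \<subseteq> V"
  using inV by auto

lemma finN [simp]: "finite (N u)"
  using N_subset finV finite_subset by blast

lemma inV1: "E u v \<Longrightarrow> u \<in> V"
  using sym inV by blast

lemma E_commute: "E u v \<longleftrightarrow> E v u"
  using sym by blast

lemma card_N: "v \<in> V \<Longrightarrow> card (N v) = 270"
  using deg by (simp add: N_def)

lemma card_N_adj: "E u v \<Longrightarrow> card (N u \<inter> N v) = 105"
  using lam by (simp add: N_def)

lemma card_N_nonadj: "\<lbrakk>u \<in> V; v \<in> V; u \<noteq> v; \<not> E u v\<rbrakk> \<Longrightarrow> card (N u \<inter> N v) = 27"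
  using mu by (simp add: N_def)

lemma card_Int_eq_sum:
  assumes "finite C"
  shows "real (card (N y \<inter> C)) = (\<Sum>c\<in>C. of_bool (E y c))"
proof -
  have "(\<Sum>c\<in>C. of_bool (E y c)) = (\<Sum>c\<in>C. if c \<in> N y then 1 else (0::real))"
    by (intro sum.cong) auto
  also have "\<dots> = real (card (C \<inter> N y))"
    using assms by (simp add: sum.If_cases Int_def)
  finally show ?thesis by (simp add: Int_commute)
qed

lemma sum_card_Int:
  assumes "finite C" "finite D"
  shows "(\<Sum>y\<in>D. real (card (N y \<inter> C))) = (\<Sum>c\<in>C. real (card (N c \<inter> D)))"
proof -
  have "(\<Sum>y\<in>D. real (card (N y \<inter> C))) = (\<Sum>y\<in>D. \<Sum>c\<in>C. of_bool (E y c))"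
    using assms by (simp add: card_Int_eq_sum)
  also have "\<dots> = (\<Sum>c\<in>C. \<Sum>y\<in>D. of_bool (E y c))"
    by (rule sum.swap)
  also have "\<dots> = (\<Sum>c\<in>C. real (card (N c \<inter> D)))"
    using assms by (simp add: card_Int_eq_sum E_commute)
  finally show ?thesis .
qed

text \<open>Double counting of triples \<open>(y, c, c')\<close> with \<open>y\<close> joined to
  both. The case \<open>c = c'\<close> is included, so the diagonal terms are degrees into
  \<open>D\<close>.\<close>

lemma sum_card_Int_sq:
  assumes "finite C" "finite D"
  shows "(\<Sum>y\<in>D. (real (card (N y \<inter> C)))\<^sup>2) = (\<Sum>c\<in>C. \<Sum>c'\<in>C. real (card (N c \<inter> N c' \<inter> D)))"
proof -
  have *: "real (card (N c \<inter> N c' \<inter> D)) = (\<Sum>y\<in>D. of_bool (E c y) * of_bool (E c' y))" for c c'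
  proof -
    have "(\<Sum>y\<in>D. of_bool (E c y) * of_bool (E c' y)) = (\<Sum>y\<in>D. if y \<in> N c \<inter> N c' then 1 else (0::real))"
      by (intro sum.cong) auto
    also have "\<dots> = real (card (D \<inter> (N c \<inter> N c')))"
      using assms by (simp add: sum.If_cases Int_def)
    finally show ?thesis by (simp add: Int_commute Int_left_commute)
  qed
  have "(\<Sum>y\<in>D. (real (card (N y \<inter> C)))\<^sup>2) = (\<Sum>y\<in>D. (\<Sum>c\<in>C. \<Sum>c'\<in>C. of_bool (E y c) * of_bool (E y c')))"
    using assms unfolding power2_eq_square card_Int_eq_sum[OF assms(1)] sum_product by simp
  also have "\<dots> = (\<Sum>c\<in>C. \<Sum>y\<in>D. \<Sum>c'\<in>C. of_bool (E y c) * of_bool (E y c'))"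
    by (rule sum.swap)
  also have "\<dots> = (\<Sum>c\<in>C. \<Sum>c'\<in>C. \<Sum>y\<in>D. of_bool (E y c) * of_bool (E y c'))"
    by (intro sum.cong refl sum.swap)
  also have "\<dots> = (\<Sum>c\<in>C. \<Sum>c'\<in>C. real (card (N c \<inter> N c' \<inter> D)))"
    unfolding * by (intro sum.cong refl) (auto simp: E_commute)
  finally show ?thesis .
qed

section \<open>The matrix A + 3 I and its quadratic form\<close>

text \<open>\<open>apB\<close> applies \<open>B = A + 3 I\<close>, where \<open>A\<close> is the adjacency matrix.\<close>

definition apB :: "('a \<Rightarrow> real) \<Rightarrow> 'a \<Rightarrow> real" where
  "apB f u = 3 * f u + (\<Sum>v\<in>N u. f v)"

lemma sum_N: "(\<Sum>v\<in>N u. f v) = (\<Sum>v\<in>V. of_bool (E u v) * (f v :: real))"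
  by (rule sum.mono_neutral_cong_left) (use finV N_subset in auto)

lemma apB_eq:
  assumes "u \<in> V"
  shows "apB f u = (\<Sum>v\<in>V. (3 * of_bool (u = v) + of_bool (E u v)) * f v)"
proof -
  have "(\<Sum>v\<in>V. 3 * of_bool (u = v) * f v) = (\<Sum>v\<in>V. if u = v then 3 * f v else 0)"
    by (intro sum.cong) auto
  also have "\<dots> = 3 * f u"
    using assms finV by simp
  finally show ?thesis
    by (simp add: apB_def sum_N algebra_simps sum.distrib)
qed

text \<open>Self-adjointness of B, from the symmetry of its entries.\<close>

lemma sum_apB_swap: "(\<Sum>u\<in>V. g u * apB f u) = (\<Sum>u\<in>V. apB g u * f u)"
proof -
  have "(\<Sum>u\<in>V. g u * apB f u)
      = (\<Sum>u\<in>V. \<Sum>v\<in>V. g u * ((3 * of_bool (u = v) + of_bool (E u v)) * f v))"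
    by (intro sum.cong refl) (simp add: apB_eq sum_distrib_left)
  also have "\<dots> = (\<Sum>v\<in>V. \<Sum>u\<in>V. g u * ((3 * of_bool (u = v) + of_bool (E u v)) * f v))"
    by (rule sum.swap)
  also have "\<dots> = (\<Sum>v\<in>V. (\<Sum>u\<in>V. (3 * of_bool (v = u) + of_bool (E v u)) * g u) * f v)"
    unfolding sum_distrib_right
    by (intro sum.cong refl) (auto simp: E_commute)
  also have "\<dots> = (\<Sum>u\<in>V. apB g u * f u)"
    by (intro sum.cong refl) (simp add: apB_eq)
  finally show ?thesis .
qed

lemma sum_apB: "(\<Sum>u\<in>V. apB f u) = 273 * (\<Sum>u\<in>V. f u)"
proof -
  have "(\<Sum>u\<in>V. apB f u) = (\<Sum>u\<in>V. apB (\<lambda>_. 1) u * f u)"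
    using sum_apB_swap[of "\<lambda>_. 1" f] by simp
  also have "\<dots> = (\<Sum>u\<in>V. 273 * f u)"
    by (intro sum.cong refl) (simp add: apB_def card_N)
  finally show ?thesis by (simp add: sum_distrib_left)
qed

text \<open>The parameters give A^2 = 270 I + 105 A + 27 (J - I - A) = 243 I + 78 A + 27 J; adding 6
  A + 9 I turns this into 84 B + 27 J.\<close>

lemma apB_apB:
  assumes "u \<in> V"
  shows "apB (apB f) u = 84 * apB f u + 27 * (\<Sum>v\<in>V. f v)"
proof -
  have A2: "(\<Sum>v\<in>N u. \<Sum>w\<in>N v. f w) = (\<Sum>w\<in>V. real (card (N u \<inter> N w)) * f w)"
  proof -
    have "(\<Sum>v\<in>N u. \<Sum>w\<in>N v. f w) = (\<Sum>v\<in>N u. \<Sum>w\<in>V. of_bool (E v w) * f w)"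
      by (simp add: sum_N)
    also have "\<dots> = (\<Sum>w\<in>V. (\<Sum>v\<in>N u. of_bool (E w v)) * f w)"
      unfolding sum_distrib_right by (subst sum.swap) (simp add: E_commute)
    also have "\<dots> = (\<Sum>w\<in>V. real (card (N w \<inter> N u)) * f w)"
      by (simp add: card_Int_eq_sum)
    finally show ?thesis by (simp add: Int_commute)
  qed
  have c: "real (card (N u \<inter> N w)) = 243 * of_bool (u = w) + 78 * of_bool (E u w) + 27" if "w \<in> V" for w
    using card_N[OF assms] card_N_adj[of u w] card_N_nonadj[OF assms that] irrefl
    by (cases "u = w"; cases "E u w") auto
  have "(\<Sum>w\<in>V. real (card (N u \<inter> N w)) * f w)
    = (\<Sum>w\<in>V. (78 * (3 * of_bool (u = w) + of_bool (E u w)) + 9 * of_bool (u = w) + 27) * f w)"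
    by (intro sum.cong refl) (simp add: c)
  also have "\<dots> = 78 * (\<Sum>w\<in>V. (3 * of_bool (u = w) + of_bool (E u w)) * f w)
     + 9 * (\<Sum>w\<in>V. of_bool (u = w) * f w) + 27 * (\<Sum>w\<in>V. f w)"
    unfolding sum_distrib_left sum.distrib[symmetric] by (intro sum.cong refl) (simp add: algebra_simps)
  also have "(\<Sum>w\<in>V. of_bool (u = w) * f w) = (\<Sum>w\<in>V. if u = w then f w else 0)"
    by (intro sum.cong) auto
  also have "\<dots> = f u" using assms finV by simp
  finally have A2': "(\<Sum>v\<in>N u. \<Sum>w\<in>N v. f w) = 78 * apB f u + 9 * f u + 27 * (\<Sum>w\<in>V. f w)"
    using A2 apB_eq[OF assms] by simp
  have "apB (apB f) u = 3 * apB f u + 3 * (\<Sum>v\<in>N u. f v) + (\<Sum>v\<in>N u. \<Sum>w\<in>N v. f w)"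
    by (simp add: apB_def sum.distrib sum_distrib_left)
  with A2' show ?thesis
    by (simp add: apB_def)
qed

text \<open>\<open>B\<^sup>2 = 84 B + 27 J\<close> makes \<open>M = B - J / 7\<close> satisfy \<open>M\<^sup>2 = 84 M\<close>, so \<open>M\<close> is positive semidefinite.\<close>

lemma psd: "(\<Sum>u\<in>V. f u)\<^sup>2 \<le> 7 * (\<Sum>u\<in>V. f u * apB f u)"
proof -
  define s where "s = (\<Sum>u\<in>V. f u)"
  define Q where "Q = (\<Sum>u\<in>V. f u * apB f u)"
  have sq: "(\<Sum>u\<in>V. apB f u * apB f u) = 84 * Q + 27 * s * s"
  proof -
    have "(\<Sum>u\<in>V. apB f u * apB f u) = (\<Sum>u\<in>V. f u * apB (apB f) u)"
      by (rule sum_apB_swap[symmetric])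
    also have "\<dots> = (\<Sum>u\<in>V. 84 * (f u * apB f u) + 27 * s * f u)"
      by (intro sum.cong refl) (simp add: apB_apB s_def algebra_simps)
    also have "\<dots> = 84 * Q + 27 * s * s"
      by (simp add: sum.distrib flip: sum_distrib_left) (simp add: Q_def s_def)
    finally show ?thesis .
  qed
  \<comment> \<open>The squared terms are the entries of \<open>M f\<close>. As M is symmetric with
    M^2 = 84 M, their sum is 84 times the quadratic form of M at \<open>f\<close>.\<close>
  have "0 \<le> (\<Sum>u\<in>V. (apB f u - s / 7)\<^sup>2)"
    by (intro sum_nonneg) simp
  also have "\<dots> = (\<Sum>u\<in>V. apB f u * apB f u - 2 * s / 7 * apB f u + s * s / 49)"
    by (intro sum.cong refl) (simp add: power2_eq_square algebra_simps)
  also have "\<dots> = (84 * Q + 27 * s * s) - 2 * s / 7 * (273 * s) + 1911 * (s * s / 49)"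
    unfolding sum.distrib sum_subtractf sum_distrib_left[symmetric] sq sum_apB
    by (simp add: cardV s_def)
  also have "\<dots> = 84 * (Q - s * s / 7)"
    by (simp add: algebra_simps)
  finally have "s * s \<le> 7 * Q" by simp
  then show ?thesis
    by (simp add: s_def Q_def power2_eq_square)
qed

text \<open>This is \<open>psd\<close> for the vector that is 1 on \<open>K\<close>,
  \<open>- g\<close> on \<open>W\<close> and 0 elsewhere. When the matrix induced on
  \<open>W\<close> is understood, an optimal \<open>g\<close> gives the strongest constraint on
  \<open>K\<close>.\<close>

lemma psd_sets:
  assumes "K \<subseteq> V" "W \<subseteq> V" "K \<inter> W = {}"
  shows "(real (card K) - (\<Sum>w\<in>W. g w))\<^sup>2 \<le> 7 * ((\<Sum>y\<in>K. 3 + real (card (N y \<inter> K)))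
     - 2 * (\<Sum>w\<in>W. g w * real (card (N w \<inter> K))) + (\<Sum>w\<in>W. g w * (3 * g w + (\<Sum>u\<in>N w \<inter> W. g u))))"
proof -
  have fin: "finite K" "finite W"
    using assms(1,2) finV by (meson finite_subset)+
  define f where "f = (\<lambda>u. if u \<in> K then 1 else if u \<in> W then - g u else 0)"
  have split: "(\<Sum>u\<in>X. f u * p u) = (\<Sum>u\<in>X \<inter> K. p u) - (\<Sum>u\<in>X \<inter> W. g u * p u)" if "finite X" for X p
  proof -
    have "(\<Sum>u\<in>X. f u * p u) = (\<Sum>u\<in>X. (if u \<in> K then p u else 0) + (if u \<in> W then - g u * p u else 0))"
      using assms by (intro sum.cong refl) (auto simp: f_def)
    also have "\<dots> = (\<Sum>u\<in>X \<inter> K. p u) + (\<Sum>u\<in>X \<inter> W. - g u * p u)"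
      using that by (simp add: sum.distrib sum.If_cases Int_def)
    finally show ?thesis by (simp add: sum_negf)
  qed
  have VK: "V \<inter> K = K" "V \<inter> W = W" using assms by auto
  have nb: "(\<Sum>v\<in>N u. f v) = real (card (N u \<inter> K)) - (\<Sum>v\<in>N u \<inter> W. g v)" for u
    using split[of "N u" "\<lambda>_. 1"] by simp
  have sf: "(\<Sum>u\<in>V. f u) = real (card K) - (\<Sum>w\<in>W. g w)"
    using split[OF finV, of "\<lambda>_. 1"] by (simp add: VK)
  have sw: "(\<Sum>y\<in>K. \<Sum>v\<in>N y \<inter> W. g v) = (\<Sum>w\<in>W. g w * real (card (N w \<inter> K)))"
  proof -
    have "(\<Sum>y\<in>K. \<Sum>v\<in>N y \<inter> W. g v) = (\<Sum>y\<in>K. \<Sum>v\<in>W. if v \<in> N y then g v else 0)"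
      using fin by (simp add: sum.If_cases Int_commute N_def)
    also have "\<dots> = (\<Sum>v\<in>W. \<Sum>y\<in>K. g v * of_bool (E v y))"
      by (subst sum.swap) (intro sum.cong refl, auto simp: E_commute)
    finally show ?thesis
      using fin by (simp add: card_Int_eq_sum sum_distrib_left[symmetric])
  qed
  have "(\<Sum>u\<in>V. f u * apB f u) = (\<Sum>u\<in>K. apB f u) - (\<Sum>w\<in>W. g w * apB f w)"
    using split[OF finV, of "apB f"] by (simp add: VK)
  also have "(\<Sum>u\<in>K. apB f u) = (\<Sum>u\<in>K. 3 + real (card (N u \<inter> K)) - (\<Sum>v\<in>N u \<inter> W. g v))"
    by (intro sum.cong refl) (simp add: apB_def nb, simp add: f_def)
  also have "\<dots> = (\<Sum>y\<in>K. 3 + real (card (N y \<inter> K))) - (\<Sum>w\<in>W. g w * real (card (N w \<inter> K)))"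
    by (simp add: sum_subtractf sw)
  also have "(\<Sum>w\<in>W. g w * apB f w)
      = (\<Sum>w\<in>W. g w * real (card (N w \<inter> K)) - g w * (3 * g w + (\<Sum>u\<in>N w \<inter> W. g u)))"
  proof (intro sum.cong refl)
    fix w assume "w \<in> W"
    then have "f w = - g w" using assms by (auto simp: f_def)
    then show "g w * apB f w = g w * real (card (N w \<inter> K)) - g w * (3 * g w + (\<Sum>u\<in>N w \<inter> W. g u))"
      unfolding apB_def nb by (simp add: algebra_simps)
  qed
  finally show ?thesis
    using psd[of f] unfolding sf by (simp add: sum_subtractf algebra_simps)
qed

section \<open>Cliques have at most 28 vertices\<close>

definition clique :: "'a set \<Rightarrow> bool" where
  "clique C \<longleftrightarrow> C \<subseteq> V \<and> (\<forall>u\<in>C. \<forall>v\<in>C. u \<noteq> v \<longrightarrow> E u v)"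

lemma clique_subset: "clique C \<Longrightarrow> D \<subseteq> C \<Longrightarrow> clique D"
  unfolding clique_def by blast

lemma clique_Un:
  assumes "clique C" "clique D" "\<And>c d. c \<in> C \<Longrightarrow> d \<in> D \<Longrightarrow> c \<noteq> d \<Longrightarrow> E c d"
  shows "clique (C \<union> D)"
  unfolding clique_def
proof (intro conjI ballI impI)
  show "C \<union> D \<subseteq> V" using assms(1,2) by (auto simp: clique_def)
  fix u v assume uv: "u \<in> C \<union> D" "v \<in> C \<union> D" "u \<noteq> v"
  show "E u v"
  proof (cases "u \<in> C")
    case True
    then show ?thesis using uv assms(1,3) by (auto simp: clique_def)
  next
    case False
    then show ?thesis using uv assms(2) sym[OF assms(3)[of v u]] by (auto simp: clique_def)
  qed
qed

lemma clique_insert: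
  assumes "clique C" "y \<in> V" "\<And>c. c \<in> C \<Longrightarrow> c \<noteq> y \<Longrightarrow> E y c"
  shows "clique (insert y C)"
proof -
  have "clique (C \<union> {y})"
  proof (rule clique_Un[OF assms(1)])
    show "clique {y}" using assms(2) by (simp add: clique_def)
    show "E c d" if "c \<in> C" "d \<in> {y}" "c \<noteq> d" for c d
      using that sym[OF assms(3)[of c]] by simp
  qed
  then show ?thesis by simp
qed

lemma clique_finite: "clique C \<Longrightarrow> finite C"
  using finV finite_subset unfolding clique_def by blast

lemma clique_nbrs: "clique C \<Longrightarrow> c \<in> C \<Longrightarrow> N c \<inter> C = C - {c}"
  using irrefl unfolding clique_def by auto

section \<open>Quadratic inequalities for a clique and a disjoint set\<close>

text \<open>On a clique B is 2 I + J, so M is 2 I + (6/7) J, which is invertible. The bound is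
  \<open>psd_sets\<close> with the minimising weight on \<open>C\<close>, that is, a Schur
  complement, multiplied by \<open>7 + 3 * m\<close> to clear denominators.\<close>

lemma clique_ineq:
  fixes m q S s2 e2 :: real
  assumes C: "clique C" and K: "K \<subseteq> V" "K \<inter> C = {}"
    and m: "m = card C" and q: "q = card K"
    and S: "S = (\<Sum>c\<in>C. real (card (N c \<inter> K)))"
    and s2: "s2 = (\<Sum>c\<in>C. (real (card (N c \<inter> K)))\<^sup>2)"
    and e2: "e2 = (\<Sum>y\<in>K. real (card (N y \<inter> K)))"
  shows "7 * (7 + 3 * m) * s2 - q * S * (7 + 3 * m) - (q + 3 * S) * (7 * S - m * q)
           \<le> (42 * q + 14 * e2 - 2 * q\<^sup>2) * (7 + 3 * m)"
proof -
  have fC: "finite C" using C clique_finite by blast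
  define \<beta> where "\<beta> = (\<lambda>c. real (card (N c \<inter> K)))"
  \<comment> \<open>With \<open>\<beta> c\<close> the number of neighbours of \<open>c\<close> in
    \<open>K\<close> and \<open>G\<close> the sum of \<open>g\<close>, the minimiser satisfies 2 g +
    (6/7) G = \<beta> - q/7. So \<open>g\<close> is \<open>\<beta> / 2\<close> plus a constant, and
    summing over \<open>C\<close> determines that constant.\<close>
  define \<rho> where "\<rho> = - (q + 3 * S) / (14 + 6 * m)"
  define g where "g = (\<lambda>c. \<beta> c / 2 + \<rho>)"
  define G where "G = S / 2 + m * \<rho>"
  have m0: "m \<ge> 0" by (simp add: m)
  have \<rho>: "\<rho> * (14 + 6 * m) = - (q + 3 * S)"
    using m0 by (simp add: \<rho>_def)
  have G: "(\<Sum>c\<in>C. g c) = G"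
    by (simp add: g_def G_def sum.distrib S m \<beta>_def flip: sum_divide_distrib)
  have nb: "(\<Sum>u\<in>N c \<inter> C. g u) = G - g c" if "c \<in> C" for c
    using that fC by (simp add: clique_nbrs[OF C] sum_diff1 G)
  have "(\<Sum>c\<in>C. g c * (3 * g c + (\<Sum>u\<in>N c \<inter> C. g u))) - 2 * (\<Sum>c\<in>C. g c * \<beta> c)
      = (\<Sum>c\<in>C. g c * (2 * g c + G) - 2 * (g c * \<beta> c))"
    unfolding sum_subtractf sum_distrib_left[symmetric]
    by (simp add: nb algebra_simps)
  also have "\<dots> = (\<Sum>c\<in>C. - ((\<beta> c)\<^sup>2 / 2) + G / 2 * \<beta> c + \<rho> * (2 * \<rho> + G))"
    by (intro sum.cong refl) (simp add: g_def field_simps power2_eq_square)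
  also have "\<dots> = - s2 / 2 + G / 2 * S + m * (\<rho> * (2 * \<rho> + G))"
    by (simp add: sum.distrib sum_subtractf s2 S m \<beta>_def sum_negf flip: sum_divide_distrib sum_distrib_left)
  finally have X: "(\<Sum>c\<in>C. g c * (3 * g c + (\<Sum>u\<in>N c \<inter> C. g u))) - 2 * (\<Sum>c\<in>C. g c * \<beta> c)
      = - s2 / 2 + G / 2 * S + m * (\<rho> * (2 * \<rho> + G))" .
  have "(q - G)\<^sup>2 \<le> 7 * (3 * q + e2 + (- s2 / 2 + G / 2 * S + m * (\<rho> * (2 * \<rho> + G))))"
    using psd_sets[of K C g] K C G X
    by (simp add: clique_def q e2 sum.distrib \<beta>_def algebra_simps)
  then have "0 \<le> (7 + 3 * m) * (14 * (3 * q + e2 + (- s2 / 2 + G / 2 * S + m * (\<rho> * (2 * \<rho> + G)))) - 2 * (q - G)\<^sup>2)"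
    using m0 by simp
  also have "\<dots> = (7 + 3 * m) * (42 * q + 14 * e2 - 2 * q\<^sup>2 - 7 * s2 + 3 * S\<^sup>2 + 2 * q * S)
      + m * (\<rho> * (14 + 6 * m))\<^sup>2 + 2 * m * (\<rho> * (14 + 6 * m)) * (q + 3 * S)"
    by (simp add: G_def algebra_simps power2_eq_square)
  also have "\<dots> = (42 * q + 14 * e2 - 2 * q\<^sup>2) * (7 + 3 * m)
      - (7 * (7 + 3 * m) * s2 - q * S * (7 + 3 * m) - (q + 3 * S) * (7 * S - m * q))"
    unfolding \<rho> by (simp add: algebra_simps power2_eq_square)
  finally show ?thesis by simp
qed

text \<open>The case \<open>K = {y}\<close>, where first and second moments coincide. The left side
  is concave in \<open>t\<close>, so a middle range of \<open>t\<close> is excluded.\<close>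

lemma clique_single:
  assumes C: "clique C" and y: "y \<in> V - C" and t: "t = real (card (N y \<inter> C))" and m: "m = real (card C)"
  shows "21 * t * (m - t) + 35 * t \<le> 280 + 119 * m"
proof -
  have fC: "finite C" using C clique_finite by blast
  have b: "real (card (N c \<inter> {y})) = of_bool (E y c)" for c
    using card_Int_eq_sum[of "{y}" c] by (simp add: E_commute)
  have S: "t = (\<Sum>c\<in>C. real (card (N c \<inter> {y})))"
    using fC by (simp add: b t card_Int_eq_sum)
  have S2: "t = (\<Sum>c\<in>C. (real (card (N c \<inter> {y})))\<^sup>2)"
    unfolding S by (intro sum.cong refl) (simp add: b)
  have e: "0 = (\<Sum>z\<in>{y}. real (card (N z \<inter> {y})))"
    using irrefl by (simp add: card_eq_0_iff)
  have "7 * (7 + 3 * m) * t - 1 * t * (7 + 3 * m) - (1 + 3 * t) * (7 * t - m * 1)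
           \<le> (42 * 1 + 14 * 0 - 2 * 1\<^sup>2) * (7 + 3 * m)"
    by (rule clique_ineq[OF C _ _ m _ S S2 e]) (use y in auto)
  then show ?thesis by (simp add: algebra_simps)
qed

text \<open>All neighbours of \<open>y\<close> in \<open>C\<close> are also neighbours of
  \<open>c\<close>, and the non-adjacent \<open>y\<close> and \<open>c\<close> have only 27 common
  neighbours.\<close>

lemma clique_t_le:
  assumes C: "clique C" and "y \<in> V" "c \<in> C" "y \<noteq> c" "\<not> E y c"
  shows "card (N y \<inter> C) \<le> 27"
proof -
  have "N y \<inter> C \<subseteq> N y \<inter> N c"
    using assms unfolding clique_def by (metis IntE IntI in_N subsetI)
  moreover have "card (N y \<inter> N c) = 27"
    using assms by (intro card_N_nonadj) (auto simp: clique_def)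
  ultimately show ?thesis
    by (metis card_mono finite_Int finN)
qed

section \<open>Moments of the degrees into a clique, and first clique bounds\<close>

text \<open>Each vertex of \<open>C\<close> has 270 - (m - 1) neighbours outside \<open>C\<close>,
  and two vertices of \<open>C\<close> have 105 - (m - 2) common neighbours outside.\<close>

lemma clique_sums:
  assumes C: "clique C" and m: "m = real (card C)"
  shows "(\<Sum>y\<in>V - C. real (card (N y \<inter> C))) = m * (271 - m)"
    and "(\<Sum>y\<in>V - C. (real (card (N y \<inter> C)))\<^sup>2) = m * (271 - m) + m * (m - 1) * (107 - m)"
proof -
  have fC: "finite C" and CV: "C \<subseteq> V" using C clique_finite clique_def by auto
  have t: "real (card (N y \<inter> C)) = m - 1" if "y \<in> C" for y
  proof -
    have "card C > 0" using that fC card_gt_0_iff by blast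
    then show ?thesis using that fC by (simp add: clique_nbrs[OF C] m of_nat_diff)
  qed
  have NV: "N c \<inter> V = N c" for c using N_subset by auto
  have "(\<Sum>y\<in>V. real (card (N y \<inter> C))) = (\<Sum>c\<in>C. real (card (N c)))"
    unfolding sum_card_Int[OF fC finV] NV ..
  also have "\<dots> = 270 * m"
    using CV by (simp add: card_N subset_iff m)
  finally have 1: "(\<Sum>y\<in>V. real (card (N y \<inter> C))) = 270 * m" .
  have "(\<Sum>y\<in>C. real (card (N y \<inter> C))) = m * (m - 1)"
    by (simp add: t m)
  with 1 show "(\<Sum>y\<in>V - C. real (card (N y \<inter> C))) = m * (271 - m)"
    using sum.subset_diff[OF CV finV, of "\<lambda>y. real (card (N y \<inter> C))"] by (simp add: algebra_simps)
  have "(\<Sum>y\<in>V. (real (card (N y \<inter> C)))\<^sup>2) = (\<Sum>c\<in>C. \<Sum>c'\<in>C. real (card (N c \<inter> N c')))"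
    using fC finV by (simp add: sum_card_Int_sq NV Int_assoc)
  also have "\<dots> = (\<Sum>c\<in>C. \<Sum>c'\<in>C. 105 + (if c = c' then 165 else 0))"
  proof (intro sum.cong refl)
    fix c c' assume "c \<in> C" "c' \<in> C"
    then show "real (card (N c \<inter> N c')) = 105 + (if c = c' then 165 else 0)"
      using C card_N card_N_adj unfolding clique_def by (auto simp: subset_iff)
  qed
  also have "\<dots> = (\<Sum>c\<in>C. 105 * m + 165)"
    using fC by (intro sum.cong refl) (simp add: sum.distrib m)
  also have "\<dots> = m * (105 * m + 165)" by (simp add: m)
  finally have 2: "(\<Sum>y\<in>V. (real (card (N y \<inter> C)))\<^sup>2) = m * (105 * m + 165)" .
  have "(\<Sum>y\<in>C. (real (card (N y \<inter> C)))\<^sup>2) = m * (m - 1)\<^sup>2"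
    by (simp add: t m)
  with 2 show "(\<Sum>y\<in>V - C. (real (card (N y \<inter> C)))\<^sup>2) = m * (271 - m) + m * (m - 1) * (107 - m)"
    using sum.subset_diff[OF CV finV, of "\<lambda>y. (real (card (N y \<inter> C)))\<^sup>2"]
    by (simp add: algebra_simps power2_eq_square)
qed

text \<open>The weight t (t - 7) is positive only for t > 7. A large total therefore forces many
  vertices with high degree into \<open>C\<close>.\<close>

lemma clique_t_t7:
  assumes C: "clique C" and m: "m = real (card C)"
  shows "(\<Sum>y\<in>V - C. real (card (N y \<inter> C)) * (real (card (N y \<inter> C)) - 7))
    = m * ((m - 1) * (107 - m) - 6 * (271 - m))"
proof -
  have "(\<Sum>y\<in>V - C. real (card (N y \<inter> C)) * (real (card (N y \<inter> C)) - 7))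
    = (\<Sum>y\<in>V - C. (real (card (N y \<inter> C)))\<^sup>2) - 7 * (\<Sum>y\<in>V - C. real (card (N y \<inter> C)))"
    by (simp add: power2_eq_square algebra_simps sum_subtractf sum_distrib_left)
  then show ?thesis
    unfolding clique_sums[OF assms] by (simp add: algebra_simps)
qed

text \<open>This is the Delsarte bound 1 + 270 / 3. For 91 vertices the mean degree into the clique
  is exactly 9, and the sum of squared deviations from 9 would be negative for any larger
  clique.\<close>

lemma clique_card_le_91:
  assumes C: "clique C"
  shows "card C \<le> 91"
proof (rule ccontr)
  assume "\<not> card C \<le> 91"
  define m where "m = real (card C)"
  have m: "m \<ge> 92" using \<open>\<not> card C \<le> 91\<close> by (simp add: m_def)
  have fC: "finite C" and CV: "C \<subseteq> V" using C clique_finite clique_def by auto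
  have "card C \<le> 1911" using CV cardV finV card_mono by metis
  then have cd: "real (card (V - C)) = 1911 - m"
    using fC CV by (simp add: card_Diff_subset cardV m_def of_nat_diff)
  have "0 \<le> (\<Sum>y\<in>V - C. (real (card (N y \<inter> C)) - 9)\<^sup>2)"
    by (intro sum_nonneg) simp
  also have "\<dots> = (\<Sum>y\<in>V - C. (real (card (N y \<inter> C)))\<^sup>2 - 18 * real (card (N y \<inter> C)) + 81)"
    by (intro sum.cong refl) (simp add: power2_eq_square algebra_simps)
  also have "\<dots> = m * (271 - m) + m * (m - 1) * (107 - m) - 18 * (m * (271 - m)) + 81 * (1911 - m)"
    unfolding sum.distrib sum_subtractf sum_distrib_left[symmetric] clique_sums[OF C m_def]
    by (simp add: cd)
  also have "\<dots> = - (m - 91) * (m * (m - 34) + 1701)"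
    by (simp add: algebra_simps)
  also have "\<dots> < 0"
  proof -
    have "m * (m - 34) + 1701 > 0" using m by (intro add_nonneg_pos mult_nonneg_nonneg) auto
    then show ?thesis using m by (simp add: mult_neg_pos)
  qed
  finally show False by simp
qed

text \<open>A vertex outside a maximum clique misses some member, so its degree \<open>t\<close>
  into the clique is at most 27. For m at least 33 the single-vertex inequality excludes 8 to 27, so
  every weight t (t - 7) is at most 0, while their total is positive.\<close>

lemma clique_card_le_32:
  assumes "clique C"
  shows "card C \<le> 32"
proof (rule ccontr)
  assume big: "\<not> card C \<le> 32"
  have "\<forall>D. clique D \<longrightarrow> card D < 92"
  proof (intro allI impI)
    fix D assume "clique D"
    from clique_card_le_91[OF this] show "card D < 92" by simp
  qed
  then obtain M where M: "clique M" "\<And>D. clique D \<Longrightarrow> card D \<le> card M"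
    using ex_has_greatest_nat[of clique C card 92] assms by blast
  define m where "m = real (card M)"
  have m: "33 \<le> m" "m \<le> 91"
    using M(2)[OF assms] big clique_card_le_91[OF M(1)] by (auto simp: m_def)
  have "real (card (N y \<inter> M)) * (real (card (N y \<inter> M)) - 7) \<le> 0" if y: "y \<in> V - M" for y
  proof -
    define t where "t = real (card (N y \<inter> M))"
    have "\<not> clique (insert y M)"
      using M(2)[of "insert y M"] y clique_finite[OF M(1)] by auto
    then obtain c where "c \<in> M" "\<not> E y c"
      using clique_insert[OF M(1)] y by blast
    then have t27: "t \<le> 27"
      using clique_t_le[OF M(1), of y c] y by (auto simp: t_def)
    have ineq: "21 * t * (m - t) + 35 * t \<le> 280 + 119 * m"
      using clique_single[OF M(1) y t_def m_def] .
    have "t < 8"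
    proof (rule ccontr)
      assume "\<not> t < 8"
      then have "(t - 8) * (27 - t) \<ge> 0" "(m - 33) * (21 * t - 119) \<ge> 0"
        using t27 m by auto
      then show False using ineq t27 by (simp add: algebra_simps)
    qed
    then have "t \<le> 7" unfolding t_def by simp
    then show ?thesis unfolding t_def[symmetric] by (simp add: mult_nonneg_nonpos t_def)
  qed
  then have "m * ((m - 1) * (107 - m) - 6 * (271 - m)) \<le> 0"
    unfolding clique_t_t7[OF M(1) m_def, symmetric] by (rule sum_nonpos)
  \<comment> \<open>The factor (m - 1) (107 - m) - 6 (271 - m) exceeds this product by 1270 - 10 m,
    which is positive up to 91.\<close>
  moreover have "(m - 33) * (91 - m) \<ge> 0" using m by simp
  then have "(m - 1) * (107 - m) - 6 * (271 - m) > 0"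
    using m by (simp add: algebra_simps)
  ultimately show False using m by (simp add: mult_le_0_iff)
qed

text \<open>The common neighbours of \<open>y\<close> and \<open>c\<close> inside \<open>C\<close>
  are all neighbours of \<open>y\<close> there; those in \<open>X\<close> lie outside. Both kinds
  share the budget of 27.\<close>

lemma common_outside_clique:
  assumes C: "clique C" and y: "y \<in> V - C" and c: "c \<in> C" "\<not> E y c" and X: "X \<subseteq> N y \<inter> N c - C"
  shows "card X + card (N y \<inter> C) \<le> 27"
proof -
  have "N y \<inter> C \<subseteq> N y \<inter> N c"
    using C c unfolding clique_def by (metis IntE IntI in_N subsetI)
  then have sub: "X \<union> (N y \<inter> C) \<subseteq> N y \<inter> N c" using X by blast
  have fX: "finite X" using X by (rule finite_subset) simp
  have "card X + card (N y \<inter> C) = card (X \<union> (N y \<inter> C))"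
    by (rule card_Un_disjoint[symmetric]) (use X fX in auto)
  also have "\<dots> \<le> card (N y \<inter> N c)"
    using sub by (intro card_mono) auto
  also have "\<dots> = 27"
    using C y c by (intro card_N_nonadj) (auto simp: clique_def)
  finally show ?thesis .
qed

lemma card_missed_add: "finite C \<Longrightarrow> card (C - N y) + card (N y \<inter> C) = card C"
  using card_Int_Diff[of C "N y"] by (simp only: Int_commute[of "N y"])

lemma sum_card_missed:
  assumes "finite C" "finite K"
  shows "(\<Sum>c\<in>C. real (card (K - N c))) = (\<Sum>y\<in>K. real (card (C - N y)))"
proof -
  have 1: "real (card (N c \<inter> K)) = real (card K) - real (card (K - N c))" for c
    using card_missed_add[OF assms(2), of c] by linarith
  have 2: "real (card (N c \<inter> C)) = real (card C) - real (card (C - N c))" for c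
    using card_missed_add[OF assms(1), of c] by linarith
  show ?thesis
    using sum_card_Int[OF assms(2,1)] unfolding 1 2 sum_subtractf by (simp add: mult.commute)
qed

text \<open>A vertex of \<open>C\<close> missed by some vertex of \<open>Q\<close> is missed by almost all of \<open>Q\<close>, as otherwise
  the two would have too many common neighbours in \<open>C \<union> Q\<close>.\<close>

lemma clique_merge:
  assumes C: "clique C" and Q: "clique Q" and disj: "C \<inter> Q = {}"
    and a: "\<And>y. y \<in> Q \<Longrightarrow> card (C - N y) \<le> a"
  obtains D where "D \<subseteq> C" "clique ((C - D) \<union> Q)"
    "real (card D) * (real (card Q) + real (card C) - 27 - real a) \<le> real a * real (card Q)"
proof -
  define D where "D = {c \<in> C. \<exists>y\<in>Q. \<not> E y c}"
  have fin: "finite C" "finite Q" "finite D"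
    using C Q clique_finite by (auto simp: D_def)
  have DC: "D \<subseteq> C" by (auto simp: D_def)
  have cl: "clique ((C - D) \<union> Q)"
    by (rule clique_Un[OF clique_subset[OF C] Q]) (auto simp: D_def E_commute)
  have up: "real (card (N c \<inter> Q)) \<le> 27 - real (card C) + real a" if "c \<in> D" for c
  proof -
    from that obtain y where y: "c \<in> C" "y \<in> Q" "\<not> E y c" by (auto simp: D_def)
    have yV: "y \<in> V - C" using y Q disj by (auto simp: clique_def)
    have "N c \<inter> Q \<subseteq> N y \<inter> N c - C"
    proof
      fix x assume x: "x \<in> N c \<inter> Q"
      then have "E y x" using y Q sym unfolding clique_def by (metis IntE in_N)
      then show "x \<in> N y \<inter> N c - C" using x disj by auto
    qed
    from common_outside_clique[OF C yV y(1,3) this] card_missed_add[OF fin(1), of y] a[OF y(2)]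
    show ?thesis by linarith
  qed
  have lo: "real (card (N y \<inter> D)) \<ge> real (card D) - real a" if "y \<in> Q" for y
  proof -
    have "card (D - N y) \<le> card (C - N y)"
      using fin DC by (intro card_mono) auto
    then show ?thesis
      using card_missed_add[OF fin(3), of y] a[OF that] by linarith
  qed
  \<comment> \<open>The edges between \<open>Q\<close> and \<open>D\<close> are counted from both
    sides: each vertex of \<open>Q\<close> misses few of \<open>D\<close>, each vertex of
    \<open>D\<close> has few neighbours in \<open>Q\<close>.\<close>
  have "real (card Q) * (real (card D) - real a) = (\<Sum>y\<in>Q. real (card D) - real a)"
    by simp
  also have "\<dots> \<le> (\<Sum>y\<in>Q. real (card (N y \<inter> D)))"
    by (rule sum_mono) (rule lo)
  also have "\<dots> = (\<Sum>c\<in>D. real (card (N c \<inter> Q)))"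
    by (rule sum_card_Int[OF fin(3,2)])
  also have "\<dots> \<le> (\<Sum>c\<in>D. 27 - real (card C) + real a)"
    by (rule sum_mono) (rule up)
  also have "\<dots> = real (card D) * (27 - real (card C) + real a)"
    by simp
  finally have "real (card D) * (real (card Q) + real (card C) - 27 - real a) \<le> real a * real (card Q)"
    by (simp add: algebra_simps)
  with DC cl show ?thesis by (rule that)
qed

section \<open>Pairwise non-adjacent vertices outside a clique\<close>

text \<open>Rewrites \<open>clique_ineq\<close> in terms of missed vertices, which are few in the
  applications. The second moment enters with a positive factor, so a lower bound \<open>b2\<close>
  for it suffices.\<close>

lemma coclique_ineq:
  fixes m q B b2 :: real
  assumes C: "clique C" and K: "K \<subseteq> V" "K \<inter> C = {}" "\<And>u v. u \<in> K \<Longrightarrow> v \<in> K \<Longrightarrow> \<not> E u v"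
    and m: "m = card C" and q: "q = card K"
    and B: "B = (\<Sum>y\<in>K. real (card (C - N y)))"
    and b2: "b2 \<le> (\<Sum>c\<in>C. (real (card (K - N c)))\<^sup>2)"
  shows "7 * (7 + 3 * m) * (q\<^sup>2 * m - 2 * q * B + b2) - q * (q * m - B) * (7 + 3 * m)
      - (q + 3 * (q * m - B)) * (7 * (q * m - B) - m * q) \<le> (42 * q - 2 * q\<^sup>2) * (7 + 3 * m)"
proof -
  have fin: "finite C" "finite K" using C clique_finite K finV finite_subset by metis+
  have c1: "real (card (N c \<inter> K)) = q - real (card (K - N c))" for c
    using card_missed_add[OF fin(2), of c] q by linarith
  have SB: "(\<Sum>c\<in>C. real (card (K - N c))) = B"
    unfolding B by (rule sum_card_missed[OF fin])
  then have S: "(\<Sum>c\<in>C. real (card (N c \<inter> K))) = q * m - B"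
    by (simp add: c1 sum_subtractf m)
  have "(\<Sum>c\<in>C. (real (card (N c \<inter> K)))\<^sup>2)
      = (\<Sum>c\<in>C. q\<^sup>2 - 2 * q * real (card (K - N c)) + (real (card (K - N c)))\<^sup>2)"
    by (intro sum.cong refl) (simp add: c1 power2_eq_square algebra_simps)
  also have "\<dots> = q\<^sup>2 * m - 2 * q * B + (\<Sum>c\<in>C. (real (card (K - N c)))\<^sup>2)"
    unfolding sum.distrib sum_subtractf sum_distrib_left[symmetric] SB by (simp add: m)
  finally have S2: "q\<^sup>2 * m - 2 * q * B + b2 \<le> (\<Sum>c\<in>C. (real (card (N c \<inter> K)))\<^sup>2)"
    using b2 by simp
  have e: "0 = (\<Sum>y\<in>K. real (card (N y \<inter> K)))"
  proof -
    have "N y \<inter> K = {}" if "y \<in> K" for y using K(3) that by auto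
    then show ?thesis by simp
  qed
  have "7 * (7 + 3 * m) * (\<Sum>c\<in>C. (real (card (N c \<inter> K)))\<^sup>2) - q * (q * m - B) * (7 + 3 * m)
      - (q + 3 * (q * m - B)) * (7 * (q * m - B) - m * q) \<le> (42 * q + 14 * 0 - 2 * q\<^sup>2) * (7 + 3 * m)"
    by (rule clique_ineq[OF C K(1,2) m q S[symmetric] refl e])
  moreover have "7 * (7 + 3 * m) * (q\<^sup>2 * m - 2 * q * B + b2) \<le> 7 * (7 + 3 * m) * (\<Sum>c\<in>C. (real (card (N c \<inter> K)))\<^sup>2)"
    using S2 m by (intro mult_left_mono) auto
  ultimately show ?thesis by simp
qed

text \<open>A natural number is at most its square, so the total \<open>B\<close> of missed vertices
  itself serves as \<open>b2\<close>. This is used to rule out independent triples of vertices that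
  miss little of \<open>C\<close>.\<close>

lemma triple_ineq:
  fixes m B :: real
  assumes C: "clique C" and K: "x \<in> V - C" "y \<in> V - C" "z \<in> V - C"
    and ne: "x \<noteq> y" "x \<noteq> z" "y \<noteq> z" "\<not> E x y" "\<not> E x z" "\<not> E y z"
    and m: "m = card C"
    and B: "B = real (card (C - N x)) + real (card (C - N y)) + real (card (C - N z))"
  shows "7 * (7 + 3 * m) * (9 * m - 5 * B) - 3 * (3 * m - B) * (7 + 3 * m)
      - (3 + 3 * (3 * m - B)) * (7 * (3 * m - B) - m * 3) \<le> 108 * (7 + 3 * m)"
proof -
  have fin: "finite C" using C clique_finite by blast
  have Bs: "B = (\<Sum>y\<in>{x,y,z}. real (card (C - N y)))" using ne by (simp add: B)
  have SB: "(\<Sum>c\<in>C. real (card ({x,y,z} - N c))) = B"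
    unfolding Bs by (rule sum_card_missed) (simp_all add: fin)
  have "(\<Sum>c\<in>C. real (card ({x,y,z} - N c))) \<le> (\<Sum>c\<in>C. (real (card ({x,y,z} - N c)))\<^sup>2)"
  proof (rule sum_mono)
    fix c
    have "card ({x,y,z} - N c) \<le> (card ({x,y,z} - N c))\<^sup>2" by (simp add: power2_eq_square)
    then show "real (card ({x,y,z} - N c)) \<le> (real (card ({x,y,z} - N c)))\<^sup>2"
      by (metis of_nat_le_iff of_nat_power)
  qed
  then have b2: "B \<le> (\<Sum>c\<in>C. (real (card ({x,y,z} - N c)))\<^sup>2)" by (simp add: SB)
  have "7 * (7 + 3 * m) * (3\<^sup>2 * m - 2 * 3 * B + B) - 3 * (3 * m - B) * (7 + 3 * m)
      - (3 + 3 * (3 * m - B)) * (7 * (3 * m - B) - m * 3) \<le> (42 * 3 - 2 * 3\<^sup>2) * (7 + 3 * m)"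
  proof (rule coclique_ineq[OF C _ _ _ m _ Bs b2])
    show "\<not> E u v" if "u \<in> {x,y,z}" "v \<in> {x,y,z}" for u v
      using that ne irrefl by (auto simp: E_commute)
  qed (use K ne in auto)
  then show ?thesis by simp
qed

text \<open>For two vertices the second moment is exactly \<open>B + 2 * s\<close>, since a vertex
  missed by both contributes 4 instead of 2. A large overlap \<open>s\<close> thus forces
  adjacency.\<close>

lemma pair_ineq:
  fixes m B s :: real
  assumes C: "clique C" and K: "x \<in> V - C" "y \<in> V - C"
    and ne: "x \<noteq> y" "\<not> E x y"
    and m: "m = card C"
    and B: "B = real (card (C - N x)) + real (card (C - N y))"
    and s: "s = real (card (C - N x - N y))"
  shows "7 * (7 + 3 * m) * (4 * m - 3 * B + 2 * s) - 2 * (2 * m - B) * (7 + 3 * m)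
      - (2 + 3 * (2 * m - B)) * (7 * (2 * m - B) - m * 2) \<le> 76 * (7 + 3 * m)"
proof -
  have fin: "finite C" using C clique_finite by blast
  have Bs: "B = (\<Sum>y\<in>{x,y}. real (card (C - N y)))" using ne by (simp add: B)
  have *: "(\<Sum>c\<in>C. of_bool (c \<in> X)) = real (card X)" if "X \<subseteq> C" for X
    using that fin by (simp add: Int_absorb1 of_bool_def sum.If_cases)
  have "(\<Sum>c\<in>C. (real (card ({x,y} - N c)))\<^sup>2)
    = (\<Sum>c\<in>C. of_bool (c \<in> C - N x) + of_bool (c \<in> C - N y) + 2 * of_bool (c \<in> C - N x - N y))"
  proof (intro sum.cong refl)
    fix c assume c: "c \<in> C"
    have "{x,y} - N c = (if E x c then {} else {x}) \<union> (if E y c then {} else {y})"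
      by (auto simp: E_commute)
    then have "card ({x,y} - N c) = of_bool (\<not> E x c) + of_bool (\<not> E y c)"
      using ne by auto
    then show "(real (card ({x,y} - N c)))\<^sup>2
      = of_bool (c \<in> C - N x) + of_bool (c \<in> C - N y) + 2 * of_bool (c \<in> C - N x - N y)"
      using c by auto
  qed
  also have "\<dots> = B + 2 * s"
    unfolding sum.distrib sum_distrib_left[symmetric] B s by (intro arg_cong2[where f = "(+)"] arg_cong2[where f = "(*)"] refl *) auto
  finally have b2: "B + 2 * s \<le> (\<Sum>c\<in>C. (real (card ({x,y} - N c)))\<^sup>2)" by simp
  have "7 * (7 + 3 * m) * (2\<^sup>2 * m - 2 * 2 * B + (B + 2 * s)) - 2 * (2 * m - B) * (7 + 3 * m)
      - (2 + 3 * (2 * m - B)) * (7 * (2 * m - B) - m * 2) \<le> (42 * 2 - 2 * 2\<^sup>2) * (7 + 3 * m)"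
  proof (rule coclique_ineq[OF C _ _ _ m _ Bs b2])
    show "\<not> E u v" if "u \<in> {x,y}" "v \<in> {x,y}" for u v
      using that ne irrefl by (auto simp: E_commute)
  qed (use K ne in auto)
  then show ?thesis by (simp add: algebra_simps)
qed

lemma sum_indicator_le:
  fixes f :: "'a \<Rightarrow> real"
  assumes "\<And>y. y \<in> V - C \<Longrightarrow> f y \<le> p * of_bool (y \<in> H) + q * of_bool (y \<in> F)"
    and "H \<subseteq> V - C" "F \<subseteq> V - C"
  shows "sum f (V - C) \<le> p * real (card H) + q * real (card F)"
proof -
  have *: "(\<Sum>y\<in>V - C. of_bool (y \<in> X)) = real (card X)" if "X \<subseteq> V - C" for X
    using that finV by (simp add: of_bool_def sum.If_cases Int_absorb1)
  have "sum f (V - C) \<le> (\<Sum>y\<in>V - C. p * of_bool (y \<in> H) + q * of_bool (y \<in> F))"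
    by (rule sum_mono) (rule assms(1))
  also have "\<dots> = p * real (card H) + q * real (card F)"
    by (simp only: sum.distrib sum_distrib_left[symmetric] *[OF assms(2)] *[OF assms(3)])
  finally show ?thesis .
qed

section \<open>Excluding cliques of 30 and 29 vertices\<close>

text \<open>For a 30-clique \<open>C\<close>, the moment sum yields at least 42 vertices that miss 3
  to 5 of \<open>C\<close>. Among them is a clique of 20, whose merger with \<open>C\<close> exceeds
  32.\<close>

lemma clique_card_le_29:
  assumes "clique C0"
  shows "card C0 \<le> 29"
proof (rule ccontr)
  assume "\<not> card C0 \<le> 29"
  then obtain C where "C \<subseteq> C0" and c30: "card C = 30"
    using obtain_subset_with_card_n[of 30 C0] by auto
  then have C: "clique C" using assms clique_subset by blast
  have fC: "finite C" and CV: "C \<subseteq> V" using C clique_finite clique_def by auto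
  define F where "F = {y \<in> V - C. C \<subseteq> N y}"
  define H where "H = {y \<in> V - C. 25 \<le> card (N y \<inter> C) \<and> card (N y \<inter> C) \<le> 27}"
  have finH: "finite H" and finF: "finite F" using finV by (auto simp: H_def F_def)
  have "clique F"
    unfolding clique_def
  proof (intro conjI ballI impI)
    fix u v assume uv: "u \<in> F" "v \<in> F" "u \<noteq> v"
    show "E u v"
    proof (rule ccontr)
      assume "\<not> E u v"
      then have "card (N u \<inter> N v) = 27"
        using uv by (intro card_N_nonadj) (auto simp: F_def)
      moreover have "card C \<le> card (N u \<inter> N v)"
        using uv by (intro card_mono) (auto simp: F_def)
      ultimately show False using c30 by simp
    qed
  qed (auto simp: F_def)
  then have "clique (F \<union> C)"
    by (rule clique_Un[OF _ C]) (auto simp: F_def)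
  then have "card (F \<union> C) \<le> 32" by (rule clique_card_le_32)
  moreover have "card (F \<union> C) = card F + card C"
    using finF fC by (intro card_Un_disjoint) (auto simp: F_def)
  ultimately have F2: "card F \<le> 2" using c30 by simp
  have bound: "real (card (N y \<inter> C)) * (real (card (N y \<inter> C)) - 7)
      \<le> 540 * of_bool (y \<in> H) + 690 * of_bool (y \<in> F)" if y: "y \<in> V - C" for y
  proof -
    define t where "t = card (N y \<inter> C)"
    have t30: "t \<le> 30" unfolding t_def c30[symmetric] using fC by (intro card_mono) auto
    have ineq: "21 * real t * (30 - real t) + 35 * real t \<le> 280 + 119 * 30"
      by (rule clique_single[OF C y]) (simp_all add: t_def c30)
    \<comment> \<open>For m = 30 the single-vertex inequality fails exactly on the integers from 8
      to 24. Above 27 nothing can be missed, by \<open>clique_t_le\<close>.\<close>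
    consider "t \<le> 7" | "25 \<le> t" "t \<le> 27" | "t > 27"
    proof (rule ccontr)
      assume "\<not> thesis"
      with that have "8 \<le> t" "t \<le> 24" by linarith+
      then have "(real t - 8) * (24 - real t) \<ge> 0" by simp
      then show False using ineq \<open>t \<le> 24\<close> by (simp add: algebra_simps)
    qed
    then show ?thesis
    proof cases
      case 1
      then have "real t * (real t - 7) \<le> 0" by (simp add: mult_nonneg_nonpos)
      also have "\<dots> \<le> 540 * of_bool (y \<in> H) + 690 * of_bool (y \<in> F)" by simp
      finally show ?thesis by (simp add: t_def)
    next
      case 2
      then have "real t * (real t - 7) \<le> 27 * 20" by (intro mult_mono) auto
      moreover have "y \<in> H" using 2 y by (simp add: H_def t_def)
      ultimately show ?thesis by (simp add: t_def)
    next
      case 3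
      have "C \<subseteq> N y"
      proof
        fix c assume c: "c \<in> C"
        show "c \<in> N y"
          using clique_t_le[OF C _ c, of y] 3 y c by (auto simp: t_def)
      qed
      then have "y \<in> F" using y by (simp add: F_def)
      moreover have "real t * (real t - 7) \<le> 30 * 23" using 3 t30 by (intro mult_mono) auto
      ultimately show ?thesis by (simp add: t_def)
    qed
  qed
  \<comment> \<open>Here 23610 = 30 (29 * 77 - 6 * 241), and the largest weights are 27 * 20 on
    \<open>H\<close> and 30 * 23 on \<open>F\<close>.\<close>
  have "23610 \<le> 540 * real (card H) + 690 * real (card F)"
    using sum_indicator_le[OF bound] clique_t_t7[OF C refl] c30 by (force simp: H_def F_def)
  then have h42: "card H \<ge> 42" using F2 by linarith
  have missed: "card (C - N y) + card (N y \<inter> C) = 30" for y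
    using card_missed_add[OF fC] c30 by simp
  have share: "E x y" if xy: "x \<in> H" "y \<in> H" "x \<noteq> y" and c: "c \<in> C - N x - N y" for x y c
  proof (rule ccontr)
    assume "\<not> E x y"
    define B where "B = real (card (C - N x)) + real (card (C - N y))"
    define s where "s = real (card (C - N x - N y))"
    have "card (C - N x - N y) > 0" using c fC by (auto simp: card_gt_0_iff)
    then have s: "s \<ge> 1" by (simp add: s_def)
    have B: "6 \<le> B" "B \<le> 10"
      using missed[of x] missed[of y] xy by (auto simp: H_def B_def)
    have "7 * (7 + 3 * 30) * (4 * 30 - 3 * B + 2 * s) - 2 * (2 * 30 - B) * (7 + 3 * 30)
      - (2 + 3 * (2 * 30 - B)) * (7 * (2 * 30 - B) - 30 * 2) \<le> 76 * (7 + 3 * 30)"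
      by (rule pair_ineq[OF C _ _ _ _ _ B_def s_def]) (use xy \<open>\<not> E x y\<close> c30 in \<open>auto simp: H_def\<close>)
    moreover have "(B - 6) * (10 - B) \<ge> 0" using B by simp
    ultimately show False using s B by (simp add: algebra_simps)
  qed
  have triple: False if xyz: "x \<in> H" "y \<in> H" "z \<in> H" "x \<noteq> y" "x \<noteq> z" "y \<noteq> z"
      "\<not> E x y" "\<not> E x z" "\<not> E y z" for x y z
  proof -
    define B where "B = real (card (C - N x)) + real (card (C - N y)) + real (card (C - N z))"
    have B: "9 \<le> B" "B \<le> 15"
      using missed[of x] missed[of y] missed[of z] xyz by (auto simp: H_def B_def)
    have "7 * (7 + 3 * 30) * (9 * 30 - 5 * B) - 3 * (3 * 30 - B) * (7 + 3 * 30)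
      - (3 + 3 * (3 * 30 - B)) * (7 * (3 * 30 - B) - 30 * 3) \<le> 108 * (7 + 3 * 30)"
      by (rule triple_ineq[OF C _ _ _ _ _ _ _ _ _ _ B_def]) (use xyz c30 in \<open>auto simp: H_def\<close>)
    moreover have "(B - 9) * (15 - B) \<ge> 0" using B by simp
    ultimately show False using B by (simp add: algebra_simps)
  qed
  obtain y where y: "y \<in> H" using h42 by fastforce
  have "card (C - N y) > 0" using missed[of y] y by (simp add: H_def)
  then have "C - N y \<noteq> {}" by (metis card.empty less_irrefl)
  then obtain c where "c \<in> C - N y" by blast
  then have c: "c \<in> C" "\<not> E y c" by auto
  \<comment> \<open>\<open>A\<close> is a clique because independent triples are impossible,
    \<open>B\<close> because its members all miss \<open>c\<close>. As \<open>y\<close> has at least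
    25 neighbours in \<open>C\<close>, at most 2 vertices are left for \<open>R\<close>, so
    \<open>A\<close> or \<open>B\<close> has 20 of the 42 vertices.\<close>
  define A where "A = {x \<in> H. x \<noteq> y \<and> \<not> E y x}"
  define B where "B = {x \<in> H. \<not> E x c}"
  define R where "R = {x \<in> H. E y x \<and> E x c}"
  have A: "clique A"
    unfolding clique_def
  proof (intro conjI ballI impI)
    show "E u v" if "u \<in> A" "v \<in> A" "u \<noteq> v" for u v
      using triple[of y u v] that y by (auto simp: A_def)
  qed (auto simp: A_def H_def)
  have B: "clique B"
    unfolding clique_def
  proof (intro conjI ballI impI)
    show "E u v" if "u \<in> B" "v \<in> B" "u \<noteq> v" for u v
      using share[of u v c] that c by (auto simp: B_def)
  qed (auto simp: B_def H_def)
  have "card R + card (N y \<inter> C) \<le> 27"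
    by (rule common_outside_clique[OF C _ c]) (use y in \<open>auto simp: R_def H_def E_commute\<close>)
  then have R: "card R \<le> 2" using y by (simp add: H_def)
  have "H \<subseteq> A \<union> B \<union> R" using c y by (auto simp: A_def B_def R_def)
  then have "card H \<le> card (A \<union> B \<union> R)"
    using finH by (intro card_mono) (auto simp: A_def B_def R_def)
  also have "\<dots> \<le> card A + card B + card R"
    by (meson card_Un_le add_mono order_trans order_refl)
  finally have "card A \<ge> 20 \<or> card B \<ge> 20" using h42 R by linarith
  then obtain Q where Q: "clique Q" "Q \<subseteq> H" "card Q \<ge> 20"
    using A B by (metis (no_types, lifting) A_def B_def mem_Collect_eq subsetI)
  have CQ: "C \<inter> Q = {}" using Q by (auto simp: H_def)
  have "card (C - N x) \<le> 5" if "x \<in> Q" for x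
    using missed[of x] that Q by (auto simp: H_def)
  from clique_merge[OF C Q(1) CQ this] obtain D where D: "D \<subseteq> C" "clique (C - D \<union> Q)"
    and ineq: "real (card D) * (real (card Q) + real (card C) - 27 - real 5) \<le> real 5 * real (card Q)"
    by blast
  \<comment> \<open>The merging bound reads |D| (|Q| - 2) \<le> 5 |Q|, which fails for |D| \<ge> 6
    once |Q| > 12. The merged clique then has at least 30 - 5 + 20 vertices.\<close>
  have "card D \<le> 5"
  proof (rule ccontr)
    assume "\<not> card D \<le> 5"
    then have "6 * (real (card Q) - 2) \<le> real (card D) * (real (card Q) - 2)"
      using Q by (intro mult_right_mono) auto
    then show False using ineq Q c30 by simp
  qed
  moreover have "card (C - D \<union> Q) = card C - card D + card Q"
    using D(1) fC CQ clique_finite[OF Q(1)] finite_subset[OF D(1) fC]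
    by (subst card_Un_disjoint) (auto simp: card_Diff_subset)
  ultimately show False
    using clique_card_le_32[OF D(2)] Q c30 by linarith
qed

text \<open>For a 29-clique the single-vertex inequality is weaker, so near-complete vertices may
  miss 2 to 6 of \<open>C\<close>. Cliques among them are small, which forces each to miss exactly
  6; the missed pairs are then too many.\<close>

lemma clique_card_le_28:
  assumes "clique C0"
  shows "card C0 \<le> 28"
proof (rule ccontr)
  assume "\<not> card C0 \<le> 28"
  then obtain C where "C \<subseteq> C0" and c29: "card C = 29"
    using obtain_subset_with_card_n[of 29 C0] by auto
  then have C: "clique C" using assms clique_subset by blast
  have fC: "finite C" and CV: "C \<subseteq> V" using C clique_finite clique_def by auto
  define H where "H = {y \<in> V - C. 23 \<le> card (N y \<inter> C) \<and> card (N y \<inter> C) \<le> 27}"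
  have finH: "finite H" using finV by (auto simp: H_def)
  have t27: "card (N y \<inter> C) \<le> 27" if y: "y \<in> V - C" for y
  proof -
    have "\<not> clique (insert y C)"
      using clique_card_le_29[of "insert y C"] y fC c29 by auto
    then obtain c where "c \<in> C" "\<not> E y c"
      using clique_insert[OF C] y by blast
    then show ?thesis using clique_t_le[OF C, of y c] y by auto
  qed
  have low: "card (N y \<inter> C) \<le> 7" if y: "y \<in> V - C" "y \<notin> H" for y
  proof -
    define t where "t = card (N y \<inter> C)"
    have ineq: "21 * real t * (29 - real t) + 35 * real t \<le> 280 + 119 * 29"
      by (rule clique_single[OF C y(1)]) (simp_all add: t_def c29)
    have "t \<le> 22" using y t27[OF y(1)] by (auto simp: H_def t_def)
    have "\<not> 8 \<le> t"
    proof
      assume "8 \<le> t"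
      then have "(real t - 8) * (22 - real t) \<ge> 0" using \<open>t \<le> 22\<close> by simp
      then show False using ineq \<open>8 \<le> t\<close> by (simp add: algebra_simps)
    qed
    then show ?thesis by (simp add: t_def)
  qed
  have weight: "21228 \<le> p * real (card H)"
    if p: "\<And>y. y \<in> H \<Longrightarrow> real (card (N y \<inter> C)) * (real (card (N y \<inter> C)) - 7) \<le> p" for p
  proof -
    have "real (card (N y \<inter> C)) * (real (card (N y \<inter> C)) - 7) \<le> p * of_bool (y \<in> H) + 0 * of_bool (y \<in> {})"
      if "y \<in> V - C" for y
      using p[of y] low[OF that] by (cases "y \<in> H") (auto simp: mult_nonneg_nonpos)
    from sum_indicator_le[OF this] show ?thesis
      using clique_t_t7[OF C refl] c29 by (force simp: H_def)
  qed
  have "21228 \<le> 540 * real (card H)"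
  proof (rule weight)
    fix y assume "y \<in> H"
    then have "real (card (N y \<inter> C)) * (real (card (N y \<inter> C)) - 7) \<le> 27 * 20"
      by (intro mult_mono) (auto simp: H_def)
    then show "real (card (N y \<inter> C)) * (real (card (N y \<inter> C)) - 7) \<le> 540" by simp
  qed
  then have h40: "card H \<ge> 40" by linarith
  have missed: "card (C - N y) + card (N y \<inter> C) = 29" for y
    using card_missed_add[OF fC] c29 by simp
  have m26: "2 \<le> card (C - N y) \<and> card (C - N y) \<le> 6" if "y \<in> H" for y
    using missed[of y] that by (auto simp: H_def)
  \<comment> \<open>Eleven vertices would give |D| (11 + 29 - 27 - 6) \<le> 66, so |D| \<le> 9, and
    merging yields a clique of at least 31.\<close>
  have small: "card Q \<le> 10" if Q: "clique Q" "Q \<subseteq> H" for Q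
  proof (rule ccontr)
    assume "\<not> card Q \<le> 10"
    then obtain P where P: "P \<subseteq> Q" "card P = 11"
      using obtain_subset_with_card_n[of 11 Q] by auto
    have cP: "clique P" using P Q clique_subset by blast
    have CP: "C \<inter> P = {}" using P Q by (auto simp: H_def)
    have "card (C - N x) \<le> 6" if "x \<in> P" for x
      using m26 that P Q by auto
    from clique_merge[OF C cP CP this] obtain D where D: "D \<subseteq> C" "clique (C - D \<union> P)"
      and ineq: "real (card D) * (real (card P) + real (card C) - 27 - real 6) \<le> real 6 * real (card P)"
      by blast
    have "card D \<le> 9" using ineq P c29 by simp
    moreover have "card (C - D \<union> P) = card C - card D + card P"
      using D(1) fC CP clique_finite[OF cP] finite_subset[OF D(1) fC]
      by (subst card_Un_disjoint) (auto simp: card_Diff_subset)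
    ultimately show False
      using clique_card_le_29[OF D(2)] P c29 by linarith
  qed
  have pair: "7 * (7 + 3 * 29) * (4 * 29 - 3 * B + 2 * s) - 2 * (2 * 29 - B) * (7 + 3 * 29)
      - (2 + 3 * (2 * 29 - B)) * (7 * (2 * 29 - B) - 29 * 2) \<le> 76 * (7 + 3 * 29)"
    if "x \<in> H" "y \<in> H" "x \<noteq> y" "\<not> E x y" "B = real (card (C - N x)) + real (card (C - N y))"
      "s = real (card (C - N x - N y))" for x y B s
    by (rule pair_ineq[OF C _ _ _ _ _ that(5,6)]) (use that c29 in \<open>auto simp: H_def\<close>)
  have share2: "E x y" if xy: "x \<in> H" "y \<in> H" "x \<noteq> y" and s2: "card (C - N x - N y) \<ge> 2" for x y
  proof (rule ccontr)
    assume n: "\<not> E x y"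
    define B where "B = real (card (C - N x)) + real (card (C - N y))"
    define s where "s = real (card (C - N x - N y))"
    have s: "s \<ge> 2" using s2 by (simp add: s_def)
    have "(B - 4) * (12 - B) \<ge> 0"
      using m26[OF xy(1)] m26[OF xy(2)] by (intro mult_nonneg_nonneg) (auto simp: B_def)
    moreover have "B \<ge> 4" using m26[OF xy(1)] m26[OF xy(2)] by (simp add: B_def)
    ultimately show False
      using pair[OF xy n B_def s_def] s by (simp add: algebra_simps)
  qed
  have share: "E x y" if xy: "x \<in> H" "y \<in> H" "x \<noteq> y" and c: "c \<in> C - N x - N y"
      and 3: "card (C - N x) \<ge> 3" for x y c
  proof (rule ccontr)
    assume n: "\<not> E x y"
    define B where "B = real (card (C - N x)) + real (card (C - N y))"
    define s where "s = real (card (C - N x - N y))"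
    have "card (C - N x - N y) > 0" using c fC by (auto simp: card_gt_0_iff)
    then have s: "s \<ge> 1" by (simp add: s_def)
    \<comment> \<open>The lower bound 5 matters: for B = 4 and s = 1 the pair inequality is still
      satisfied.\<close>
    have "(B - 5) * (12 - B) \<ge> 0"
      using m26[OF xy(1)] m26[OF xy(2)] 3 by (intro mult_nonneg_nonneg) (auto simp: B_def)
    moreover have "B \<ge> 5" using 3 m26[OF xy(2)] by (simp add: B_def)
    ultimately show False
      using pair[OF xy n B_def s_def] s by (simp add: algebra_simps)
  qed
  \<comment> \<open>One vertex missing at most 5 keeps the total at most 17; for a total of 18 the
    triple inequality gives no contradiction.\<close>
  have triple: False if xyz: "x \<in> H" "y \<in> H" "z \<in> H" "x \<noteq> y" "x \<noteq> z" "y \<noteq> z"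
      "\<not> E x y" "\<not> E x z" "\<not> E y z" and 5: "card (C - N x) \<le> 5" for x y z
  proof -
    define B where "B = real (card (C - N x)) + real (card (C - N y)) + real (card (C - N z))"
    have B: "6 \<le> B" "B \<le> 17"
      using m26[OF xyz(1)] m26[OF xyz(2)] m26[OF xyz(3)] 5 by (auto simp: B_def)
    have "7 * (7 + 3 * 29) * (9 * 29 - 5 * B) - 3 * (3 * 29 - B) * (7 + 3 * 29)
      - (3 + 3 * (3 * 29 - B)) * (7 * (3 * 29 - B) - 29 * 3) \<le> 108 * (7 + 3 * 29)"
      by (rule triple_ineq[OF C _ _ _ _ _ _ _ _ _ _ B_def]) (use xyz c29 in \<open>auto simp: H_def\<close>)
    moreover have "(B - 6) * (17 - B) \<ge> 0" using B by simp
    ultimately show False using B by (simp add: algebra_simps)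
  qed
  have nonnbrs: "card {x \<in> H. x \<noteq> y \<and> \<not> E y x} \<le> 10" if y: "y \<in> H" "card (C - N y) \<le> 5" for y
  proof (rule small)
    show "clique {x \<in> H. x \<noteq> y \<and> \<not> E y x}"
      unfolding clique_def
    proof (intro conjI ballI impI)
      show "E u v" if "u \<in> {x \<in> H. x \<noteq> y \<and> \<not> E y x}" "v \<in> {x \<in> H. x \<noteq> y \<and> \<not> E y x}" "u \<noteq> v" for u v
        using triple[of y u v] that y by auto
    qed (auto simp: H_def)
  qed auto
  have few: "card {x \<in> H. E y x \<and> E x c} + card (N y \<inter> C) \<le> 27" if y: "y \<in> H" "c \<in> C" "\<not> E y c" for y c
    by (rule common_outside_clique[OF C _ y(2,3)]) (use y in \<open>auto simp: H_def E_commute\<close>)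
  \<comment> \<open>If \<open>y\<close> misses only two vertices, the 27 common neighbours are used
    up inside \<open>C\<close>. Every neighbour of \<open>y\<close> in \<open>H\<close> then misses
    the same two, so these neighbours with \<open>y\<close> form a clique; \<open>H\<close> would
    have at most 10 + 10 vertices.\<close>
  have ge3: "card (C - N y) \<ge> 3" if y: "y \<in> H" for y
  proof (rule ccontr)
    assume "\<not> card (C - N y) \<ge> 3"
    with m26[OF y] have m2: "card (C - N y) = 2" by simp
    define B where "B = insert y {x \<in> H. E y x}"
    have sub: "C - N y \<subseteq> C - N x" if x: "x \<in> B" for x
    proof
      fix c assume c: "c \<in> C - N y"
      have "card {x \<in> H. E y x \<and> E x c} = 0"
        using few[OF y, of c] c missed[of y] m2 by auto
      then have "{x \<in> H. E y x \<and> E x c} = {}"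
        using finH by simp
      then show "c \<in> C - N x" using c x by (auto simp: B_def)
    qed
    have "clique B"
      unfolding clique_def
    proof (intro conjI ballI impI)
      show "E u v" if uv: "u \<in> B" "v \<in> B" "u \<noteq> v" for u v
      proof (rule share2)
        show "u \<in> H" "v \<in> H" using uv y by (auto simp: B_def)
        have "card (C - N y) \<le> card (C - N u - N v)"
          using sub[OF uv(1)] sub[OF uv(2)] fC by (intro card_mono) auto
        then show "2 \<le> card (C - N u - N v)" using m2 by simp
      qed (use uv in auto)
    qed (use y in \<open>auto simp: B_def H_def\<close>)
    then have "card B \<le> 10" by (rule small) (use y in \<open>auto simp: B_def\<close>)
    moreover have "card {x \<in> H. x \<noteq> y \<and> \<not> E y x} \<le> 10"
      using nonnbrs[OF y] m2 by simp
    moreover have "card H \<le> card (B \<union> {x \<in> H. x \<noteq> y \<and> \<not> E y x})"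
      using finH by (intro card_mono) (auto simp: B_def)
    moreover have "\<dots> \<le> card B + card {x \<in> H. x \<noteq> y \<and> \<not> E y x}"
      by (rule card_Un_le)
    ultimately show False using h40 by linarith
  qed
  have Hc: "card (H - N c) \<le> 10" if c: "c \<in> C" for c
  proof (rule small)
    show "clique (H - N c)"
      unfolding clique_def
    proof (intro conjI ballI impI)
      show "E u v" if "u \<in> H - N c" "v \<in> H - N c" "u \<noteq> v" for u v
        using share[of u v c] ge3[of u] that c by (auto simp: E_commute)
    qed (auto simp: H_def)
  qed auto
  \<comment> \<open>Otherwise \<open>H\<close> is covered by the non-neighbours of \<open>y\<close>,
    the vertices missing \<open>c\<close>, and the common neighbours of \<open>y\<close> and
    \<open>c\<close>: at most 10 + 10 + 3 vertices.\<close>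
  have six: "card (C - N y) = 6" if y: "y \<in> H" for y
  proof (rule ccontr)
    assume "card (C - N y) \<noteq> 6"
    with m26[OF y] have m5: "card (C - N y) \<le> 5" by linarith
    have "C - N y \<noteq> {}" using ge3[OF y] by (metis card.empty not_numeral_le_zero)
    then obtain c where "c \<in> C - N y" by blast
  then have c: "c \<in> C" "\<not> E y c" by auto
    have "H \<subseteq> {x \<in> H. x \<noteq> y \<and> \<not> E y x} \<union> (H - N c) \<union> {x \<in> H. E y x \<and> E x c}"
      using c y by (auto simp: E_commute)
    then have "card H \<le> card ({x \<in> H. x \<noteq> y \<and> \<not> E y x} \<union> (H - N c) \<union> {x \<in> H. E y x \<and> E x c})"
      using finH by (intro card_mono) auto
    also have "\<dots> \<le> card {x \<in> H. x \<noteq> y \<and> \<not> E y x} + card (H - N c) + card {x \<in> H. E y x \<and> E x c}"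
      by (meson card_Un_le add_mono order_trans order_refl)
    finally show False
      using nonnbrs[OF y m5] Hc[OF c(1)] few[OF y c] missed[of y] m5 h40 by linarith
  qed
  have t23: "card (N y \<inter> C) = 23" if "y \<in> H" for y
    using six[OF that] missed[of y] by simp
  \<comment> \<open>Now every weight is 23 * 16 = 368, so \<open>H\<close> has at least 58 vertices
    and 348 missed pairs, whereas each of the 29 vertices of \<open>C\<close> is missed at most 10
    times.\<close>
  have "21228 \<le> 368 * real (card H)"
    by (rule weight) (simp add: t23)
  then have "card H \<ge> 58" by linarith
  moreover have "6 * real (card H) = (\<Sum>y\<in>H. real (card (C - N y)))"
    by (simp add: six)
  moreover have "\<dots> = (\<Sum>c\<in>C. real (card (H - N c)))"
    by (rule sum_card_missed[OF fC finH, symmetric])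
  moreover have "\<dots> \<le> (\<Sum>c\<in>C. 10)"
    by (rule sum_mono) (use Hc in simp)
  ultimately show False using c29 by simp
qed

section \<open>Cocliques in the neighbourhood of a vertex\<close>

lemma card_local_nbrs: "k \<in> N x \<Longrightarrow> card (N k \<inter> N x) = 105"
  using card_N_adj[of k x] by (simp add: E_commute)

text \<open>The vertex \<open>x\<close> is one of the 27 common neighbours and does not lie in
  \<open>N x\<close>.\<close>

lemma card_local_common:
  assumes "u \<in> N x" "v \<in> N x" "u \<noteq> v" "\<not> E u v"
  shows "card (N u \<inter> N v \<inter> N x) \<le> 26"
proof -
  have "Suc (card (N u \<inter> N v \<inter> N x)) = card (insert x (N u \<inter> N v \<inter> N x))"
    using irrefl by simp
  also have "\<dots> \<le> card (N u \<inter> N v)"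
    using assms by (intro card_mono) (auto simp: E_commute)
  also have "\<dots> = 27"
    using assms inV by (intro card_N_nonadj) auto
  finally show ?thesis by simp
qed

definition local_coclique :: "'a \<Rightarrow> 'a set \<Rightarrow> bool" where
  "local_coclique x K \<longleftrightarrow> K \<subseteq> N x \<and> (\<forall>u\<in>K. \<forall>v\<in>K. \<not> E u v)"

lemma local_coclique_subset: "local_coclique x K \<Longrightarrow> J \<subseteq> K \<Longrightarrow> local_coclique x J"
  unfolding local_coclique_def by blast

lemma local_coclique_finite: "local_coclique x K \<Longrightarrow> finite K"
  unfolding local_coclique_def using finN finite_subset by metis

text \<open>The private neighbours of a member of a maximum coclique form a clique, and there are many
  of them when the coclique is small.\<close>

lemma ex_local_coclique_5:
  assumes x: "x \<in> V"
  shows "\<exists>K. local_coclique x K \<and> card K = 5"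
proof (rule ccontr)
  assume no5: "\<not> ?thesis"
  have le4: "card K \<le> 4" if K: "local_coclique x K" for K
  proof (rule ccontr)
    assume "\<not> card K \<le> 4"
    then obtain J where "J \<subseteq> K" "card J = 5"
      using obtain_subset_with_card_n[of 5 K] by auto
    then show False using no5 local_coclique_subset[OF K] by blast
  qed
  have "card (N x) \<noteq> 0" using card_N[OF x] by simp
  then have "N x \<noteq> {}" by (metis card.empty)
  then obtain k0 where k0: "k0 \<in> N x" by blast
  have "\<forall>J. local_coclique x J \<longrightarrow> card J < 5"
  proof (intro allI impI)
    fix J assume "local_coclique x J"
    from le4[OF this] show "card J < 5" by simp
  qed
  moreover have s0: "local_coclique x {k0}" using k0 irrefl by (simp add: local_coclique_def)
  ultimately obtain K where K: "local_coclique x K" and max: "\<And>J. local_coclique x J \<Longrightarrow> card J \<le> card K"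
    using ex_has_greatest_nat[of "local_coclique x" "{k0}" card 5] by blast
  have fK: "finite K" using K by (rule local_coclique_finite)
  have "K \<noteq> {}" using max[OF s0] by auto
  then obtain k where k: "k \<in> K" by blast
  then have kx: "k \<in> N x" using K by (auto simp: local_coclique_def)
  define P where "P = {y \<in> N k \<inter> N x. \<forall>j\<in>K - {k}. \<not> E j y}"
  have fP: "finite P" by (rule finite_subset[OF _ finN[of k]]) (auto simp: P_def)
  \<comment> \<open>Each of the at most three other members takes at most 26 of the 105 neighbours
    of \<open>k\<close>, leaving 105 - 3 * 26 = 27 private ones. Adding \<open>k\<close> and
    \<open>x\<close> gives 29.\<close>
  have "N k \<inter> N x \<subseteq> P \<union> (\<Union>j\<in>K - {k}. N k \<inter> N j \<inter> N x)"
    by (auto simp: P_def)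
  then have "card (N k \<inter> N x) \<le> card (P \<union> (\<Union>j\<in>K - {k}. N k \<inter> N j \<inter> N x))"
    using fK fP by (intro card_mono) auto
  also have "\<dots> \<le> card P + card (\<Union>j\<in>K - {k}. N k \<inter> N j \<inter> N x)"
    by (rule card_Un_le)
  also have "card (\<Union>j\<in>K - {k}. N k \<inter> N j \<inter> N x) \<le> (\<Sum>j\<in>K - {k}. card (N k \<inter> N j \<inter> N x))"
    using fK by (intro card_UN_le) auto
  also have "\<dots> \<le> (\<Sum>j\<in>K - {k}. 26)"
    by (rule sum_mono, rule card_local_common) (use K k in \<open>auto simp: local_coclique_def\<close>)
  also have "\<dots> \<le> 26 * 3"
    using le4[OF K] k fK by simp
  finally have P27: "card P \<ge> 27" using card_local_nbrs[OF kx] by simp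
  have "clique P"
    unfolding clique_def
  proof (intro conjI ballI impI)
    show "P \<subseteq> V" using inV by (auto simp: P_def)
    fix u v assume uv: "u \<in> P" "v \<in> P" "u \<noteq> v"
    show "E u v"
    proof (rule ccontr)
      assume n: "\<not> E u v"
      \<comment> \<open>Exchanging \<open>k\<close> for two non-adjacent private neighbours would
        enlarge the maximum coclique.\<close>
      have "local_coclique x (insert u (insert v (K - {k})))"
        using K uv n irrefl by (auto simp: local_coclique_def P_def E_commute)
      then have "card (insert u (insert v (K - {k}))) \<le> card K" by (rule max)
      moreover have "u \<notin> K" "v \<notin> K" using K k uv by (auto simp: local_coclique_def P_def)
      ultimately show False using uv k fK by (auto simp: card_gt_0_iff)
    qed
  qed
  then have "clique (insert k P)"
    by (rule clique_insert) (use kx inV in \<open>auto simp: P_def\<close>)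
  then have "clique (insert x (insert k P))"
    by (rule clique_insert) (use kx x in \<open>auto simp: P_def\<close>)
  then have "card (insert x (insert k P)) \<le> 28" by (rule clique_card_le_28)
  moreover have "x \<notin> insert k P" "k \<notin> P" using kx irrefl by (auto simp: P_def)
  ultimately show False using P27 fP by simp
qed

text \<open>With t the degree into \<open>K\<close>, the sum of (t - 1) (t - 2) over
  \<open>N x - K\<close> plus the total slack in \<open>card_local_common\<close> is 1045 - 3 * 525
  + 540 - 10 = 0. All terms are non-negative, since t is an integer, so all vanish.\<close>

lemma local_coclique_5_counts:
  assumes K: "local_coclique x K" and c5: "card K = 5"
  shows "\<And>y. \<lbrakk>y \<in> N x; y \<notin> K\<rbrakk> \<Longrightarrow> card (N y \<inter> K) = 1 \<or> card (N y \<inter> K) = 2"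
    and "\<And>u v. \<lbrakk>u \<in> K; v \<in> K; u \<noteq> v\<rbrakk> \<Longrightarrow> card (N u \<inter> N v \<inter> N x) = 26"
proof -
  have fK: "finite K" and Kx: "K \<subseteq> N x" and ne: "\<And>u v. u \<in> K \<Longrightarrow> v \<in> K \<Longrightarrow> \<not> E u v"
    using K local_coclique_finite by (auto simp: local_coclique_def)
  define t where "t = (\<lambda>y. real (card (N y \<inter> K)))"
  have "K \<noteq> {}" using c5 by auto
  then obtain k where "k \<in> K" by blast
  then have xV: "x \<in> V" using Kx inV1 by auto
  have tK: "t y = 0" if "y \<in> K" for y
  proof -
    have "N y \<inter> K = {}" using ne that by auto
    then show ?thesis by (simp add: t_def)
  qed
  define co where "co = (\<lambda>u v. if u = v then 0 else 26 - real (card (N u \<inter> N v \<inter> N x)))"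
  have co0: "co u v \<ge> 0" if "u \<in> K" "v \<in> K" for u v
    using card_local_common[OF subsetD[OF Kx that(1)] subsetD[OF Kx that(2)] _ ne[OF that]]
    by (simp add: co_def)
  have t1: "(\<Sum>y\<in>N x. t y) = 525"
  proof -
    have "(\<Sum>y\<in>N x. t y) = (\<Sum>k\<in>K. real (card (N k \<inter> N x)))"
      unfolding t_def by (rule sum_card_Int[OF fK finN])
    also have "\<dots> = (\<Sum>k\<in>K. 105)"
      using Kx by (intro sum.cong refl) (simp add: card_local_nbrs subset_iff)
    finally show ?thesis by (simp add: c5)
  qed
  have t2: "(\<Sum>y\<in>N x. (t y)\<^sup>2) = 1045 - (\<Sum>u\<in>K. \<Sum>v\<in>K. co u v)"
  proof -
    have "(\<Sum>y\<in>N x. (t y)\<^sup>2) = (\<Sum>u\<in>K. \<Sum>v\<in>K. real (card (N u \<inter> N v \<inter> N x)))"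
      unfolding t_def by (rule sum_card_Int_sq[OF fK finN])
    also have "\<dots> = (\<Sum>u\<in>K. \<Sum>v\<in>K. 26 + (if u = v then 79 else 0) - co u v)"
    proof (intro sum.cong refl)
      fix u v assume "u \<in> K" "v \<in> K"
      then show "real (card (N u \<inter> N v \<inter> N x)) = 26 + (if u = v then 79 else 0) - co u v"
        using card_local_nbrs[of u x] Kx by (auto simp: co_def)
    qed
    also have "\<dots> = (\<Sum>u\<in>K. 209 - (\<Sum>v\<in>K. co u v))"
      using fK by (intro sum.cong refl) (simp add: sum.distrib sum_subtractf c5)
    finally show ?thesis by (simp add: sum_subtractf c5)
  qed
  have "(\<Sum>y\<in>N x - K. (t y - 1) * (t y - 2))
      = (\<Sum>y\<in>N x. (t y - 1) * (t y - 2)) - (\<Sum>y\<in>K. (t y - 1) * (t y - 2))"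
    by (rule sum_diff) (use Kx in auto)
  also have "(\<Sum>y\<in>K. (t y - 1) * (t y - 2)) = 10"
    by (simp add: tK c5)
  also have "(\<Sum>y\<in>N x. (t y - 1) * (t y - 2)) = (\<Sum>y\<in>N x. (t y)\<^sup>2) - 3 * (\<Sum>y\<in>N x. t y) + 540"
  proof -
    have "(\<Sum>y\<in>N x. (t y - 1) * (t y - 2)) = (\<Sum>y\<in>N x. (t y)\<^sup>2 - 3 * t y + 2)"
      by (intro sum.cong refl) (simp add: power2_eq_square algebra_simps)
    also have "\<dots> = (\<Sum>y\<in>N x. (t y)\<^sup>2) - 3 * (\<Sum>y\<in>N x. t y) + 540"
      unfolding sum.distrib sum_subtractf sum_distrib_left[symmetric] by (simp add: card_N[OF xV])
    finally show ?thesis .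
  qed
  finally have total: "(\<Sum>y\<in>N x - K. (t y - 1) * (t y - 2)) + (\<Sum>u\<in>K. \<Sum>v\<in>K. co u v) = 0"
    by (simp add: t1 t2)
  have tt: "(t y - 1) * (t y - 2) \<ge> 0" for y
  proof -
    consider "card (N y \<inter> K) = 0" | "card (N y \<inter> K) = 1" | "card (N y \<inter> K) \<ge> 2" by linarith
    then show ?thesis by cases (auto simp: t_def)
  qed
  have s1: "(\<Sum>y\<in>N x - K. (t y - 1) * (t y - 2)) \<ge> 0" by (intro sum_nonneg tt)
  have s2: "(\<Sum>u\<in>K. \<Sum>v\<in>K. co u v) \<ge> 0" by (intro sum_nonneg co0)
  have z1: "(\<Sum>y\<in>N x - K. (t y - 1) * (t y - 2)) = 0" and z2: "(\<Sum>u\<in>K. \<Sum>v\<in>K. co u v) = 0"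
    using total s1 s2 by linarith+
  show "card (N y \<inter> K) = 1 \<or> card (N y \<inter> K) = 2" if "y \<in> N x" "y \<notin> K" for y
  proof -
    have "\<forall>y\<in>N x - K. (t y - 1) * (t y - 2) = 0"
      using z1 by (subst (asm) sum_nonneg_eq_0_iff) (use tt in auto)
    then have "t y = 1 \<or> t y = 2" using that by auto
    then show ?thesis by (auto simp: t_def)
  qed
  show "card (N u \<inter> N v \<inter> N x) = 26" if uv: "u \<in> K" "v \<in> K" "u \<noteq> v" for u v
  proof -
    have "\<forall>u\<in>K. (\<Sum>v\<in>K. co u v) = 0"
      using z2 by (subst (asm) sum_nonneg_eq_0_iff) (use fK co0 in \<open>auto intro: sum_nonneg\<close>)
    then have "(\<Sum>v\<in>K. co u v) = 0" using uv by blast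
    then have "\<forall>v\<in>K. co u v = 0"
      by (subst (asm) sum_nonneg_eq_0_iff) (use fK co0 uv in auto)
    then have "co u v = 0" using uv by blast
    then show ?thesis using uv by (simp add: co_def)
  qed
qed

definition priv :: "'a \<Rightarrow> 'a set \<Rightarrow> 'a \<Rightarrow> 'a set" where
  "priv x K k = {y \<in> N k \<inter> N x. \<forall>j\<in>K. E j y \<longrightarrow> j = k}"

text \<open>A neighbour of \<open>k\<close> has at most one further neighbour in \<open>K\<close>,
  so the four sets of 26 common neighbours are disjoint: 105 - 4 * 26 = 1.\<close>

lemma card_priv:
  assumes K: "local_coclique x K" and c5: "card K = 5" and k: "k \<in> K"
  shows "card (priv x K k) = 1"
proof -
  have fK: "finite K" and Kx: "K \<subseteq> N x" and ne: "\<And>u v. u \<in> K \<Longrightarrow> v \<in> K \<Longrightarrow> \<not> E u v"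
    using K local_coclique_finite by (auto simp: local_coclique_def)
  define D where "D = N k \<inter> N x"
  have D: "card D = 105" unfolding D_def using k Kx by (intro card_local_nbrs) auto
  have fD: "finite D" by (simp add: D_def)
  have "real (card (N y \<inter> (K - {k}))) = of_bool (y \<notin> priv x K k)" if y: "y \<in> D" for y
  proof -
    have yx: "y \<in> N x" "y \<notin> K" "E k y" using y k ne by (auto simp: D_def)
    have "N y \<inter> K = insert k (N y \<inter> (K - {k}))" using k yx sym by auto
    then have "card (N y \<inter> K) = Suc (card (N y \<inter> (K - {k})))" using fK by simp
    then have 01: "card (N y \<inter> (K - {k})) = 0 \<or> card (N y \<inter> (K - {k})) = 1"
      using local_coclique_5_counts(1)[OF K c5 yx(1,2)] by auto
    have "y \<in> priv x K k \<longleftrightarrow> N y \<inter> (K - {k}) = {}"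
      using y by (auto simp: priv_def D_def disjoint_iff E_commute)
    then have "y \<in> priv x K k \<longleftrightarrow> card (N y \<inter> (K - {k})) = 0"
      using fK by (simp add: card_eq_0_iff)
    then show ?thesis using 01 by auto
  qed
  then have "(\<Sum>y\<in>D. real (card (N y \<inter> (K - {k})))) = (\<Sum>y\<in>D. 1 - of_bool (y \<in> priv x K k))"
    by (intro sum.cong refl) auto
  also have "\<dots> = 105 - real (card (priv x K k))"
  proof -
    have "D \<inter> priv x K k = priv x K k" by (auto simp: D_def priv_def)
    then have "(\<Sum>y\<in>D. of_bool (y \<in> priv x K k)) = real (card (priv x K k))"
      using fD by (simp add: of_bool_def sum.If_cases)
    then show ?thesis by (simp add: sum_subtractf D)
  qed
  also have "(\<Sum>y\<in>D. real (card (N y \<inter> (K - {k})))) = (\<Sum>j\<in>K - {k}. real (card (N j \<inter> D)))"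
    using fK fD by (intro sum_card_Int) auto
  also have "\<dots> = (\<Sum>j\<in>K - {k}. 26)"
  proof (intro sum.cong refl)
    fix j assume "j \<in> K - {k}"
    then have "card (N j \<inter> N k \<inter> N x) = 26"
      using local_coclique_5_counts(2)[OF K c5, of j k] k by auto
    then show "real (card (N j \<inter> D)) = 26" by (simp add: D_def Int_assoc)
  qed
  finally show ?thesis using k c5 fK by simp
qed

section \<open>Near-cliques\<close>

definition nonnbrs :: "'a set \<Rightarrow> 'a \<Rightarrow> 'a set" where
  "nonnbrs W w = {u \<in> W. u \<noteq> w \<and> \<not> E w u}"

lemma nonnbrs_sym: "u \<in> W \<Longrightarrow> w \<in> W \<Longrightarrow> u \<in> nonnbrs W w \<longleftrightarrow> w \<in> nonnbrs W u"
  by (auto simp: nonnbrs_def E_commute)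

text \<open>Let \<open>G\<close> be the graph of non-adjacency on \<open>W\<close>: a 2-regular graph on \<open>Wc\<close> together with
  isolated vertices. On \<open>W \<union> {x}\<close> the matrix \<open>B\<close> is \<open>J\<close> plus the Laplacian of \<open>G\<close> on \<open>Wc\<close>,
  plus \<open>2 I\<close> elsewhere. The vector \<open>\<epsilon>\<close> is an eigenvector of the Laplacian for
  the eigenvalue 4, and constants on \<open>Wc\<close> are in its kernel, so that \<open>\<phi>\<close> below solves
  \<open>B \<phi> = \<epsilon> + 5/12\<close> on \<open>W \<union> {x}\<close>.\<close>

lemma half_ineq:
  fixes L q :: real
  assumes W: "W \<subseteq> N x" "card W = 30"
    and K: "K \<subseteq> N x" "K \<inter> W = {}"
    and nn: "\<And>w. w \<in> W \<Longrightarrow> nonnbrs W w \<noteq> {} \<Longrightarrow> card (nonnbrs W w) = 2"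
    and b: "\<And>y w. y \<in> K \<Longrightarrow> w \<in> W \<Longrightarrow> E y w \<longleftrightarrow> b w"
    and alt: "\<And>u w. w \<in> W \<Longrightarrow> u \<in> nonnbrs W w \<Longrightarrow> b u \<longleftrightarrow> \<not> b w"
    and L: "L = real (card {w \<in> W. nonnbrs W w \<noteq> {}})" "L > 0"
    and q: "q = real (card K)"
  shows "q\<^sup>2 * (7 * (62 - L) / 16 + 49 / 24) \<le> 7 * (\<Sum>y\<in>K. 3 + real (card (N y \<inter> K)))"
proof -
  define Wc where "Wc = {w \<in> W. nonnbrs W w \<noteq> {}}"
  define I where "I = W - Wc"
  have fW: "finite W" using W(1) finN finite_subset by blast
  have WcW: "Wc \<subseteq> W" by (auto simp: Wc_def)
  have fin: "finite Wc" "finite I" using fW WcW finite_subset by (auto simp: I_def)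
  have cI: "real (card I) = 30 - L"
    using WcW fW fin W(2) card_mono[OF fW WcW] by (simp add: I_def card_Diff_subset L(1) Wc_def of_nat_diff)
  have xW: "x \<notin> W" "x \<notin> K" using W K irrefl by auto
  \<comment> \<open>On \<open>insert x W\<close>, \<open>\<epsilon> + 1 / 2\<close> is the common
    indicator of adjacency to the vertices of \<open>K\<close>; \<open>x\<close> is adjacent to all
    of them.\<close>
  define \<epsilon> where "\<epsilon> = (\<lambda>w. if w = x \<or> b w then 1 / 2 else - 1 / 2 :: real)"
  have eps2: "\<epsilon> w * \<epsilon> w = 1 / 4" for w by (simp add: \<epsilon>_def)
  have alt': "\<epsilon> u = - \<epsilon> w" if "w \<in> Wc" "u \<in> nonnbrs W w" for u w
    using alt[of w u] that xW by (auto simp: \<epsilon>_def Wc_def nonnbrs_def)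
  have nnWc: "nonnbrs W w \<subseteq> Wc" if "w \<in> W" for w
    using that nonnbrs_sym[of _ W w] by (auto simp: Wc_def nonnbrs_def E_commute)
  have n2: "card (nonnbrs W w) = 2" if "w \<in> Wc" for w
    using nn that by (auto simp: Wc_def)
  \<comment> \<open>Summing \<open>\<epsilon>\<close> over all ends of edges of G gives twice its
    sum by 2-regularity and minus twice its sum by alternation.\<close>
  have eps0: "(\<Sum>w\<in>Wc. \<epsilon> w) = 0"
  proof -
    have s: "(\<Sum>u\<in>nonnbrs W w. p u) = (\<Sum>u\<in>Wc. of_bool (u \<in> nonnbrs W w) * p u)" if "w \<in> Wc" for w and p :: "'a \<Rightarrow> real"
      by (rule sum.mono_neutral_cong_left) (use fin nnWc[of w] that WcW in auto)
    have "(\<Sum>w\<in>Wc. \<Sum>u\<in>nonnbrs W w. \<epsilon> u) = (\<Sum>w\<in>Wc. \<Sum>u\<in>Wc. of_bool (u \<in> nonnbrs W w) * \<epsilon> u)"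
      by (intro sum.cong refl s)
    also have "\<dots> = (\<Sum>u\<in>Wc. \<Sum>w\<in>Wc. of_bool (u \<in> nonnbrs W w) * \<epsilon> u)"
      by (rule sum.swap)
    also have "\<dots> = (\<Sum>u\<in>Wc. \<Sum>w\<in>Wc. of_bool (w \<in> nonnbrs W u) * \<epsilon> u)"
      by (intro sum.cong refl) (use nonnbrs_sym[of _ W] WcW in \<open>auto simp: subset_iff\<close>)
    also have "\<dots> = (\<Sum>u\<in>Wc. \<Sum>w\<in>nonnbrs W u. \<epsilon> u)"
      by (intro sum.cong refl s[symmetric])
    also have "\<dots> = (\<Sum>u\<in>Wc. 2 * \<epsilon> u)"
      by (intro sum.cong refl) (simp add: n2)
    finally have "(\<Sum>w\<in>Wc. \<Sum>u\<in>nonnbrs W w. \<epsilon> u) = 2 * (\<Sum>u\<in>Wc. \<epsilon> u)"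
      by (simp add: sum_distrib_left)
    moreover have "(\<Sum>w\<in>Wc. \<Sum>u\<in>nonnbrs W w. \<epsilon> u) = (\<Sum>w\<in>Wc. - 2 * \<epsilon> w)"
    proof (intro sum.cong refl)
      fix w assume w: "w \<in> Wc"
      have "(\<Sum>u\<in>nonnbrs W w. \<epsilon> u) = (\<Sum>u\<in>nonnbrs W w. - \<epsilon> w)"
        by (intro sum.cong refl) (rule alt'[OF w])
      then show "(\<Sum>u\<in>nonnbrs W w. \<epsilon> u) = - 2 * \<epsilon> w" by (simp add: n2[OF w])
    qed
    ultimately show ?thesis by (simp add: sum_negf sum_distrib_left[symmetric])
  qed
  define s0 where "s0 = (\<Sum>w\<in>insert x I. \<epsilon> w / 2)"
  \<comment> \<open>\<open>\<kappa>\<close> adjusts the total of \<open>\<phi>\<close> to 5/12. This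
    is the c with (6/7) c = 1/2 - 1/7, for which \<open>q * \<phi>\<close> is the optimal weight in
    \<open>psd_sets\<close>.\<close>
  define \<kappa> where "\<kappa> = (5 / 12 - s0) / L"
  define \<phi> where "\<phi> = (\<lambda>w. if w \<in> Wc then \<epsilon> w / 4 + \<kappa> else \<epsilon> w / 2)"
  have Lc: "real (card Wc) = L" by (simp add: L Wc_def)
  have split: "(\<Sum>w\<in>insert x W. p w) = (\<Sum>w\<in>Wc. p w) + (\<Sum>w\<in>insert x I. p w)" for p :: "'a \<Rightarrow> real"
  proof -
    have eq: "insert x W = Wc \<union> insert x I" and disj: "Wc \<inter> insert x I = {}"
      using WcW xW by (auto simp: I_def)
    show ?thesis
      unfolding eq by (rule sum.union_disjoint) (use fin disj in auto)
  qed
  have phiI: "\<phi> w = \<epsilon> w / 2" if "w \<in> insert x I" for w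
    using that xW WcW by (auto simp: \<phi>_def I_def)
  have sum_phi: "(\<Sum>w\<in>insert x W. \<phi> w) = 5 / 12"
  proof -
    have "(\<Sum>w\<in>Wc. \<phi> w) = (\<Sum>w\<in>Wc. \<epsilon> w / 4 + \<kappa>)"
      by (simp add: \<phi>_def)
    also have "\<dots> = L * \<kappa>"
      by (simp add: sum.distrib eps0 Lc flip: sum_divide_distrib)
    also have "\<dots> = 5 / 12 - s0" using L by (simp add: \<kappa>_def)
    finally have "(\<Sum>w\<in>Wc. \<phi> w) = 5 / 12 - s0" .
    moreover have "(\<Sum>w\<in>insert x I. \<phi> w) = s0"
      unfolding s0_def by (rule sum.cong[OF refl phiI])
    ultimately show ?thesis unfolding split by simp
  qed
  have sum_phi_eps: "(\<Sum>w\<in>insert x W. \<phi> w * \<epsilon> w) = (62 - L) / 16"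
  proof -
    have "(\<Sum>w\<in>Wc. \<phi> w * \<epsilon> w) = (\<Sum>w\<in>Wc. 1 / 16 + \<kappa> * \<epsilon> w)"
      by (intro sum.cong refl) (simp add: \<phi>_def distrib_right eps2)
    also have "\<dots> = L / 16"
      by (simp add: sum.distrib eps0 Lc flip: sum_distrib_left)
    finally have 1: "(\<Sum>w\<in>Wc. \<phi> w * \<epsilon> w) = L / 16" .
    have "(\<Sum>w\<in>insert x I. \<phi> w * \<epsilon> w) = (\<Sum>w\<in>insert x I. 1 / 8)"
      by (intro sum.cong refl) (simp add: phiI eps2)
    also have "\<dots> = (31 - L) / 8"
      using fin xW cI by (simp add: I_def)
    finally show ?thesis unfolding split 1 by (simp add: field_simps)
  qed
  have nbW: "3 * \<phi> w + (\<Sum>u\<in>N w \<inter> insert x W. \<phi> u) = \<epsilon> w + 5 / 12" if w: "w \<in> insert x W" for w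
  proof -
    define nn' where "nn' = (if w = x then {} else nonnbrs W w)"
    have sub: "insert w nn' \<subseteq> insert x W" using w by (auto simp: nn'_def nonnbrs_def)
    have "w \<notin> nn'" by (auto simp: nn'_def nonnbrs_def)
    moreover have "finite nn'" using fW by (auto simp: nn'_def nonnbrs_def)
    moreover have "N w \<inter> insert x W = insert x W - insert w nn'"
      using w W irrefl by (auto simp: nn'_def nonnbrs_def E_commute)
    ultimately have "(\<Sum>u\<in>N w \<inter> insert x W. \<phi> u) = 5 / 12 - (\<phi> w + (\<Sum>u\<in>nn'. \<phi> u))"
      using sum_diff[OF _ sub, of \<phi>] fW sum_phi by simp
    moreover have "2 * \<phi> w - (\<Sum>u\<in>nn'. \<phi> u) = \<epsilon> w"
    proof (cases "w \<in> Wc")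
      case True
      then have "nn' = nonnbrs W w" using xW WcW by (auto simp: nn'_def)
      moreover have "(\<Sum>u\<in>nonnbrs W w. \<phi> u) = (\<Sum>u\<in>nonnbrs W w. - \<epsilon> w / 4 + \<kappa>)"
        using nnWc[of w] alt'[OF True] True WcW by (intro sum.cong refl) (auto simp: \<phi>_def)
      ultimately show ?thesis using True by (simp add: n2[OF True] \<phi>_def)
    next
      case False
      then have "nn' = {}" using w by (auto simp: nn'_def Wc_def)
      then show ?thesis using False by (simp add: \<phi>_def)
    qed
    ultimately show ?thesis by simp
  qed
  have cK: "real (card (N w \<inter> K)) = q * (\<epsilon> w + 1 / 2)" if w: "w \<in> insert x W" for w
  proof -
    have "N w \<inter> K = (if w = x \<or> b w then K else {})"
      using w K b by (auto simp: E_commute)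
    then show ?thesis by (simp add: q \<epsilon>_def)
  qed
  have "W \<noteq> {}" using W(2) by auto
  then have xV: "x \<in> V" using W(1) inV1 by auto
  have "(real (card K) - (\<Sum>w\<in>insert x W. q * \<phi> w))\<^sup>2 \<le> 7 * ((\<Sum>y\<in>K. 3 + real (card (N y \<inter> K)))
   - 2 * (\<Sum>w\<in>insert x W. q * \<phi> w * real (card (N w \<inter> K)))
   + (\<Sum>w\<in>insert x W. q * \<phi> w * (3 * (q * \<phi> w) + (\<Sum>u\<in>N w \<inter> insert x W. q * \<phi> u))))"
    by (rule psd_sets) (use xV K W xW N_subset[of x] in \<open>auto simp del: in_N\<close>)
  moreover have "(\<Sum>w\<in>insert x W. q * \<phi> w) = q * (5 / 12)"
    by (simp only: sum_distrib_left[symmetric] sum_phi)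
  moreover have "(\<Sum>w\<in>insert x W. q * \<phi> w * real (card (N w \<inter> K))) = q\<^sup>2 * ((62 - L) / 16 + 5 / 24)"
  proof -
    have "(\<Sum>w\<in>insert x W. q * \<phi> w * real (card (N w \<inter> K)))
        = (\<Sum>w\<in>insert x W. q\<^sup>2 * (\<phi> w * \<epsilon> w + 1 / 2 * \<phi> w))"
      by (intro sum.cong refl) (simp add: cK power2_eq_square algebra_simps)
    then show ?thesis
      by (simp only: sum_distrib_left[symmetric] sum.distrib sum_phi sum_phi_eps) simp
  qed
  moreover have "(\<Sum>w\<in>insert x W. q * \<phi> w * (3 * (q * \<phi> w) + (\<Sum>u\<in>N w \<inter> insert x W. q * \<phi> u)))
      = q\<^sup>2 * ((62 - L) / 16 + 25 / 144)"
  proof -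
    have "(\<Sum>w\<in>insert x W. q * \<phi> w * (3 * (q * \<phi> w) + (\<Sum>u\<in>N w \<inter> insert x W. q * \<phi> u)))
        = (\<Sum>w\<in>insert x W. q\<^sup>2 * (\<phi> w * \<epsilon> w + 5 / 12 * \<phi> w))"
    proof (intro sum.cong refl)
      fix w assume w: "w \<in> insert x W"
      have "3 * (q * \<phi> w) + (\<Sum>u\<in>N w \<inter> insert x W. q * \<phi> u)
          = q * (3 * \<phi> w + (\<Sum>u\<in>N w \<inter> insert x W. \<phi> u))"
        by (simp only: sum_distrib_left[symmetric]) (simp add: algebra_simps)
      also have "\<dots> = q * (\<epsilon> w + 5 / 12)" by (simp only: nbW[OF w])
      finally show "q * \<phi> w * (3 * (q * \<phi> w) + (\<Sum>u\<in>N w \<inter> insert x W. q * \<phi> u))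
          = q\<^sup>2 * (\<phi> w * \<epsilon> w + 5 / 12 * \<phi> w)"
        by (simp add: power2_eq_square algebra_simps)
    qed
    then show ?thesis
      by (simp only: sum_distrib_left[symmetric] sum.distrib sum_phi sum_phi_eps) simp
  qed
  ultimately have "(q - q * (5 / 12))\<^sup>2 \<le> 7 * ((\<Sum>y\<in>K. 3 + real (card (N y \<inter> K)))
      - 2 * (q\<^sup>2 * ((62 - L) / 16 + 5 / 24)) + q\<^sup>2 * ((62 - L) / 16 + 25 / 144))"
    by (simp only: q[symmetric])
  then show ?thesis by (simp add: power2_eq_square field_simps)
qed

section \<open>Cocliques of size five with three marked vertices\<close>

abbreviation pset :: "'a \<Rightarrow> 'a \<Rightarrow> 'a \<Rightarrow> 'a set \<Rightarrow> 'a set" where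
  "pset a b c R \<equiv> insert a (insert b (insert c R))"

text \<open>Marking \<open>a\<close>, \<open>b\<close>, \<open>c\<close> makes it possible to
  exchange \<open>a\<close> and \<open>b\<close> for another pair while keeping \<open>c\<close> and
  \<open>R\<close>, and to swap the roles of the marked vertices.\<close>

definition pent :: "'a \<Rightarrow> 'a \<Rightarrow> 'a \<Rightarrow> 'a \<Rightarrow> 'a set \<Rightarrow> bool" where
  "pent x a b c R \<longleftrightarrow> local_coclique x (pset a b c R) \<and> finite R \<and> card R = 2 \<and>
     a \<noteq> b \<and> a \<noteq> c \<and> b \<noteq> c \<and> a \<notin> R \<and> b \<notin> R \<and> c \<notin> R"

lemma pent_swap12: "pent x a b c R \<Longrightarrow> pent x b a c R"
  by (auto simp: pent_def insert_commute)

lemma pent_swap23: "pent x a b c R \<Longrightarrow> pent x a c b R"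
  by (auto simp: pent_def insert_commute)

lemma pent_replace:
  assumes "pent x a b c R" "u \<in> N x" "v \<in> N x" "u \<noteq> v" "\<not> E u v" "u \<notin> insert c R" "v \<notin> insert c R"
    "\<And>k. k \<in> insert c R \<Longrightarrow> \<not> E u k" "\<And>k. k \<in> insert c R \<Longrightarrow> \<not> E v k"
  shows "pent x u v c R"
  using assms irrefl by (auto simp: pent_def local_coclique_def E_commute)

lemma pent_counts:
  assumes "pent x a b c R"
  shows "local_coclique x (pset a b c R)" "card (pset a b c R) = 5"
  using assms by (auto simp: pent_def)

lemma pent_nonadj:
  assumes "pent x a b c R" "i \<in> pset a b c R" "j \<in> pset a b c R"
  shows "\<not> E i j"
  using pent_counts(1)[OF assms(1)] assms(2,3) unfolding local_coclique_def by blast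

lemma pent_priv:
  assumes "pent x a b c R" "k \<in> pset a b c R"
  shows "\<exists>z. priv x (pset a b c R) k = {z}"
  using card_priv[OF pent_counts[OF assms(1)] assms(2)] by (meson card_1_singletonE)

lemma pent_ex:
  assumes p: "pent x a b c R" and y: "y \<in> N x" "y \<notin> pset a b c R"
  shows "\<exists>k\<in>pset a b c R. E y k"
proof (rule ccontr)
  assume "\<not> ?thesis"
  then have "N y \<inter> pset a b c R = {}" by auto
  then show False
    using local_coclique_5_counts(1)[OF pent_counts[OF p] y] by simp
qed

lemma pent_le2:
  assumes p: "pent x a b c R" and y: "y \<in> N x" and ij: "i \<noteq> j" "E y i" "E y j" "k \<noteq> i" "k \<noteq> j"
    and K: "i \<in> pset a b c R" "j \<in> pset a b c R"
      "k \<in> pset a b c R"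
  shows "\<not> E y k"
proof
  assume "E y k"
  have "y \<notin> pset a b c R"
    using pent_counts(1)[OF p] ij(2) K(1) by (auto simp: local_coclique_def)
  then have "card (N y \<inter> pset a b c R) \<le> 2"
    using local_coclique_5_counts(1)[OF pent_counts[OF p] y] by auto
  moreover have "card {i, j, k} \<le> card (N y \<inter> pset a b c R)"
    using ij K \<open>E y k\<close> p by (intro card_mono) (auto simp: pent_def)
  moreover have "card {i, j, k} = 3" using ij by auto
  ultimately show False by simp
qed

text \<open>For \<open>T = insert c R\<close> these are the vertices that may replace
  \<open>a\<close> or \<open>b\<close>: any two non-adjacent ones complete \<open>T\<close> to a
  coclique of size five (\<open>rest_pent\<close>).\<close>

definition rest :: "'a \<Rightarrow> 'a set \<Rightarrow> 'a set" where
  "rest x T = {w \<in> N x. w \<notin> T \<and> (\<forall>k\<in>T. \<not> E w k)}"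

lemma pent_rest:
  assumes "pent x a b c R"
  shows "a \<in> rest x (insert c R)" "b \<in> rest x (insert c R)" "b \<in> nonnbrs (rest x (insert c R)) a"
  using assms by (auto simp: pent_def local_coclique_def rest_def nonnbrs_def)

lemma rest_pent:
  assumes "pent x a b c R" "u \<in> rest x (insert c R)" "v \<in> nonnbrs (rest x (insert c R)) u"
  shows "pent x u v c R"
  using assms by (intro pent_replace[OF assms(1)]) (auto simp: rest_def nonnbrs_def)

text \<open>Every vertex of \<open>N x\<close> outside the coclique has one or two neighbours in it.
  With none in \<open>insert c R\<close>, it sees both \<open>a\<close> and \<open>b\<close> or is
  private to one of them.\<close>

lemma rest_eq:
  assumes p: "pent x a b c R"
  shows "rest x (insert c R) = {a, b} \<union> (N a \<inter> N b \<inter> N x) \<union> priv x (pset a b c R) a \<union> priv x (pset a b c R) b"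
proof (intro equalityI subsetI)
  fix w assume w: "w \<in> rest x (insert c R)"
  show "w \<in> {a, b} \<union> (N a \<inter> N b \<inter> N x) \<union> priv x (pset a b c R) a \<union> priv x (pset a b c R) b"
  proof (cases "w = a \<or> w = b")
    case False
    then have "\<exists>k\<in>pset a b c R. E w k"
      using w by (intro pent_ex[OF p]) (auto simp: rest_def)
    then have "E w a \<or> E w b" using w by (auto simp: rest_def)
    then show ?thesis using w by (auto simp: rest_def priv_def E_commute)
  qed auto
next
  fix w assume w: "w \<in> {a, b} \<union> (N a \<inter> N b \<inter> N x) \<union> priv x (pset a b c R) a \<union> priv x (pset a b c R) b"
  have d: "a \<noteq> b" "\<And>k. k \<in> insert c R \<Longrightarrow> k \<noteq> a \<and> k \<noteq> b" using p by (auto simp: pent_def)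
  note K = pent_nonadj[OF p]
  from w consider "w = a \<or> w = b" | "E w a" "E w b" "w \<in> N x"
    | k where "k = a \<or> k = b" "w \<in> priv x (pset a b c R) k" by (auto simp: E_commute)
  then show "w \<in> rest x (insert c R)"
  proof cases
    case 1
    then show ?thesis using pent_rest[OF p] by auto
  next
    case 2
    have "\<not> E w k" if "k \<in> insert c R" for k
      using pent_le2[OF p, of w a b k] 2 d(1) d(2)[OF that] that by auto
    moreover have "w \<notin> insert c R" using 2 K[of w a] by auto
    ultimately show ?thesis using 2 by (simp add: rest_def)
  next
    case 3
    then have wk: "w \<in> N x" "E k w" by (auto simp: priv_def)
    have "\<not> E w j" if "j \<in> insert c R" for j
      using 3 d(2)[OF that] that by (auto simp: priv_def E_commute)
    moreover have "w \<notin> insert c R" using 3 wk K[of k w] by auto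
    ultimately show ?thesis using wk by (simp add: rest_def)
  qed
qed

text \<open>Of the pieces in \<open>rest_eq\<close> only \<open>b\<close> and its single private
  neighbour avoid \<open>a\<close>. Through \<open>rest_pent\<close> every vertex with a
  non-neighbour can play the role of \<open>a\<close>, which makes the non-adjacency graph 2-regular
  off its isolated vertices.\<close>

lemma rest_nonnbrs:
  assumes p: "pent x a b c R"
  shows "nonnbrs (rest x (insert c R)) a = insert b (priv x (pset a b c R) b)"
    and "card (nonnbrs (rest x (insert c R)) a) = 2"
proof -
  have ab: "a \<noteq> b" "\<not> E a b" using p by (auto simp: pent_def local_coclique_def)
  show eq: "nonnbrs (rest x (insert c R)) a = insert b (priv x (pset a b c R) b)"
    unfolding nonnbrs_def rest_eq[OF p] using ab irrefl by (auto simp: priv_def E_commute)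
  have "card (priv x (pset a b c R) b) = 1"
    by (rule card_priv[OF pent_counts[OF p]]) simp
  moreover have "b \<notin> priv x (pset a b c R) b" using irrefl by (simp add: priv_def)
  ultimately show "card (nonnbrs (rest x (insert c R)) a) = 2"
    unfolding eq by (metis Suc_1 card_1_singletonE card_insert_disjoint finite.intros One_nat_def)
qed

lemma card_rest:
  assumes p: "pent x a b c R"
  shows "card (rest x (insert c R)) = 30"
proof -
  have ab: "a \<noteq> b" "\<not> E a b" using p by (auto simp: pent_def local_coclique_def)
  obtain p1 where p1: "priv x (pset a b c R) a = {p1}"
    using pent_priv[OF p, of a] by auto
  obtain p2 where p2: "priv x (pset a b c R) b = {p2}"
    using pent_priv[OF p, of b] by auto
  have "card (N a \<inter> N b \<inter> N x) = 26"
    by (rule local_coclique_5_counts(2)[OF pent_counts[OF p]]) (use ab in auto)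
  moreover have "p1 \<in> priv x (pset a b c R) a" "p2 \<in> priv x (pset a b c R) b" using p1 p2 by auto
  then have m: "E a p1" "\<not> E b p1" "E b p2" "\<not> E a p2" using ab by (auto simp: priv_def)
  have "rest x (insert c R) = insert a (insert b (insert p1 (insert p2 (N a \<inter> N b \<inter> N x))))"
    unfolding rest_eq[OF p] p1 p2 by auto
  moreover have "a \<notin> insert b (insert p1 (insert p2 (N a \<inter> N b \<inter> N x)))"
    "b \<notin> insert p1 (insert p2 (N a \<inter> N b \<inter> N x))"
    "p1 \<notin> insert p2 (N a \<inter> N b \<inter> N x)" "p2 \<notin> N a \<inter> N b \<inter> N x"
    using m ab irrefl by (auto simp: E_commute)
  ultimately show ?thesis by simp
qed

text \<open>A vertex sees at most two members of the coclique, and \<open>c\<close> is one of them.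
  Seeing neither \<open>a\<close> nor \<open>b\<close> would make it private to
  \<open>c\<close>.\<close>

lemma pent_edge:
  assumes p: "pent x a b c R" and y: "y \<in> N x" "E y c" "\<And>k. k \<in> R \<Longrightarrow> \<not> E y k"
  shows "\<not> (E y a \<and> E y b)" and "y \<notin> priv x (pset a b c R) c \<Longrightarrow> E y a \<or> E y b"
proof -
  show "\<not> (E y a \<and> E y b)"
    using pent_le2[OF p y(1), of a c b] y p by (auto simp: pent_def)
  show "E y a \<or> E y b" if "y \<notin> priv x (pset a b c R) c"
    using that y by (auto simp: priv_def E_commute)
qed

lemma pent_common_other:
  assumes p: "pent x a b c R" and y: "y \<in> N a \<inter> N c \<inter> N x"
  shows "\<not> E y b" "\<And>k. k \<in> R \<Longrightarrow> \<not> E y k"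
proof -
  show "\<not> E y b"
    using pent_le2[OF p, of y a c b] y p by (auto simp: pent_def E_commute)
  show "\<not> E y k" if "k \<in> R" for k
  proof -
    have "k \<noteq> a" "k \<noteq> c" "a \<noteq> c" using that p by (auto simp: pent_def)
    then show ?thesis
      using pent_le2[OF p, of y a c k] y that by (auto simp: E_commute)
  qed
qed

text \<open>The private neighbour of \<open>c\<close> is the same for \<open>a, b\<close> and for \<open>u, v\<close>, hence not adjacent to \<open>a\<close>.\<close>

lemma pent_inner:
  assumes p: "pent x a b c R" and u: "u \<in> N a \<inter> N b \<inter> N x" and v: "v \<in> N a \<inter> N b \<inter> N x"
    and uv: "u \<noteq> v" "\<not> E u v" and y: "y \<in> N a \<inter> N c \<inter> N x"
  shows "E y u \<longleftrightarrow> \<not> E y v"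
proof -
  have uW: "u \<in> rest x (insert c R)" and vW: "v \<in> rest x (insert c R)"
    using rest_eq[OF p] u v by auto
  then have p': "pent x u v c R"
    using uv by (intro rest_pent[OF p]) (auto simp: nonnbrs_def)
  have yc: "y \<in> N x" "E y c" "\<And>k. k \<in> R \<Longrightarrow> \<not> E y k"
    using y pent_common_other[OF p y] by (auto simp: E_commute)
  have "y \<notin> priv x (pset u v c R) c"
  proof
    assume yp: "y \<in> priv x (pset u v c R) c"
    obtain z where z: "priv x (pset a b c R) c = {z}"
      using pent_priv[OF p, of c] by auto
    then have "z \<in> priv x (pset a b c R) c" by simp
    then have zz: "z \<in> N x" "E c z" "\<not> E a z" "\<not> E b z" "\<And>k. k \<in> R \<Longrightarrow> \<not> E k z"
      using p by (auto simp: priv_def pent_def)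
    note K = pent_nonadj[OF p]
    have "z \<notin> pset a b c R" using zz(2) K[of c z] by auto
    then have pz: "pent x a b z R"
      using p zz irrefl by (auto simp: pent_def local_coclique_def E_commute)
    have "\<not> E w z" if "w \<in> N a \<inter> N b \<inter> N x" for w
      using pent_le2[OF pz, of w a b z] that pz by (auto simp: pent_def E_commute)
    then have "\<not> E u z" "\<not> E v z" using u v by auto
    then have "z \<in> priv x (pset u v c R) c"
      using zz by (auto simp: priv_def)
    moreover have "card (priv x (pset u v c R) c) = 1"
      by (rule card_priv[OF pent_counts[OF p']]) simp
    ultimately have "y = z" using yp by (metis card_1_singletonE singletonD)
    then show False using y zz by auto
  qed
  then show ?thesis using pent_edge[OF p' yc] by blast
qed

definition alternates :: "'a \<Rightarrow> 'a set \<Rightarrow> bool" where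
  "alternates y W \<longleftrightarrow> (\<forall>w\<in>W. \<forall>u\<in>nonnbrs W w. E y u \<longleftrightarrow> \<not> E y w)"

text \<open>By \<open>pent_edge\<close>, \<open>y\<close> fails on a non-adjacent pair only if it is
  the private neighbour of \<open>c\<close> for that pair. Pairs inside the common neighbourhood are
  settled by \<open>pent_inner\<close> and the pairs containing \<open>a\<close> by adjacency. The
  at most four pairs at \<open>p1\<close> or \<open>p2\<close> exclude one vertex each.\<close>

lemma pent_alternates:
  assumes p: "pent x a b c R"
  obtains X where "finite X" "card X \<le> 4"
    "\<And>y. y \<in> N a \<inter> N c \<inter> N x - X \<Longrightarrow> alternates y (rest x (insert c R))"
proof -
  define W where "W = rest x (insert c R)"
  obtain p1 where p1: "priv x (pset a b c R) a = {p1}"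
    using pent_priv[OF p, of a] by auto
  obtain p2 where p2: "priv x (pset a b c R) b = {p2}"
    using pent_priv[OF p, of b] by auto
  have nna: "nonnbrs W a = {b, p2}"
    using rest_nonnbrs(1)[OF p] p2 by (simp add: W_def)
  have nnb: "nonnbrs W b = {a, p1}"
    using rest_nonnbrs(1)[OF pent_swap12[OF p]] p1 by (simp add: W_def insert_commute)
  have W: "W = {a, b, p1, p2} \<union> (N a \<inter> N b \<inter> N x)"
    unfolding W_def rest_eq[OF p] p1 p2 by auto
  have pW: "pent x u v c R" if "u \<in> W" "v \<in> nonnbrs W u" for u v
    using rest_pent[OF p] that by (simp add: W_def)
  define X where "X = (\<Union>u\<in>{p1, p2}. \<Union>v\<in>nonnbrs W u. priv x (pset u v c R) c)"
  have sm: "finite (\<Union>v\<in>nonnbrs W u. priv x (pset u v c R) c) \<and> card (\<Union>v\<in>nonnbrs W u. priv x (pset u v c R) c) \<le> 2"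
    if u: "u \<in> {p1, p2}" for u
  proof -
    have uW: "u \<in> W" using u W by auto
    have "\<exists>v. v \<in> nonnbrs W u"
      using u nna nnb nonnbrs_sym[of _ W u] uW W by blast
    then obtain v where v: "v \<in> nonnbrs W u" by blast
    have c2: "card (nonnbrs W u) = 2"
      using rest_nonnbrs(2)[OF pW[OF uW v]] by (simp add: W_def)
    then have f: "finite (nonnbrs W u)" using card.infinite by fastforce
    have pr: "card (priv x (pset u v c R) c) = 1" if "v \<in> nonnbrs W u" for v
      by (rule card_priv[OF pent_counts[OF pW[OF uW that]]]) simp
    have "card (\<Union>v\<in>nonnbrs W u. priv x (pset u v c R) c) \<le> (\<Sum>v\<in>nonnbrs W u. card (priv x (pset u v c R) c))"
      by (rule card_UN_le[OF f])
    also have "\<dots> = 2" using pr c2 by simp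
    finally show ?thesis using f pr by (auto intro!: card_ge_0_finite)
  qed
  show thesis
  proof (rule that)
    show "finite X" using sm by (auto simp: X_def)
    have "card X \<le> (\<Sum>u\<in>{p1, p2}. card (\<Union>v\<in>nonnbrs W u. priv x (pset u v c R) c))"
      unfolding X_def by (rule card_UN_le) simp
    also have "\<dots> \<le> (\<Sum>u\<in>{p1, p2}. 2)"
      by (rule sum_mono) (use sm in blast)
    also have "\<dots> \<le> 4" by (cases "p1 = p2") auto
    finally show "card X \<le> 4" .
    fix y assume y: "y \<in> N a \<inter> N c \<inter> N x - X"
    then have y': "y \<in> N a \<inter> N c \<inter> N x" by blast
    have yc: "y \<in> N x" "E y c" "\<And>k. k \<in> R \<Longrightarrow> \<not> E y k" and ya: "E y a"
      using y' pent_common_other[OF p y'] by (auto simp: E_commute)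
    have atmost: "\<not> (E y u \<and> E y v)" if "u \<in> W" "v \<in> nonnbrs W u" for u v
      using pent_edge(1)[OF pW[OF that] yc] .
    have pp: "E y u \<or> E y v" if "u \<in> {p1, p2}" "v \<in> nonnbrs W u" for u v
      using pent_edge(2)[OF pW yc, of u v] that y W by (auto simp: X_def)
    have ex: "E y u \<or> E y v" if uv: "u \<in> W" "v \<in> nonnbrs W u" for u v
    proof -
      have vW: "v \<in> W" and vu: "u \<in> nonnbrs W v"
        using uv nonnbrs_sym[of v W u] by (auto simp: nonnbrs_def)
      consider "u = a \<or> v = a" | "u \<in> {p1, p2}" | "v \<in> {p1, p2}" | "u = b" "v \<notin> {p1,p2}" | "v = b" "u \<notin> {p1,p2}"
        | "u \<in> N a \<inter> N b \<inter> N x" "v \<in> N a \<inter> N b \<inter> N x"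
        using uv(1) vW W by blast
      then show ?thesis
      proof cases
        case 1
        then show ?thesis using ya by auto
      next
        case 2
        then show ?thesis using pp uv by blast
      next
        case 3
        then show ?thesis using pp vu by blast
      next
        case 4
        then show ?thesis using nnb uv ya by auto
      next
        case 5
        then show ?thesis using nnb vu ya by auto
      next
        case 6
        moreover have "u \<noteq> v" "\<not> E u v" using uv by (auto simp: nonnbrs_def)
        ultimately show ?thesis using pent_inner[OF p _ _ _ _ y'] by blast
      qed
    qed
    show "alternates y (rest x (insert c R))"
      unfolding alternates_def W_def[symmetric] using atmost ex by blast
  qed
qed

lemma rest_nonnbrs_le2:
  assumes p: "pent x a b c R" and w: "w \<in> rest x (insert c R)"
  shows "nonnbrs (rest x (insert c R)) w = {} \<or> card (nonnbrs (rest x (insert c R)) w) = 2"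
  using rest_nonnbrs(2)[OF rest_pent[OF p w]] by blast

lemma pent_half:
  fixes L q :: real
  assumes p: "pent x a b c R" and W: "W = rest x (insert c R)"
    and K: "K \<subseteq> N x" "K \<inter> W = {}"
    and b: "\<And>y w. y \<in> K \<Longrightarrow> w \<in> W \<Longrightarrow> E y w \<longleftrightarrow> E y0 w" and alt: "alternates y0 W"
    and L: "L = real (card {w \<in> W. nonnbrs W w \<noteq> {}})"
    and q: "q = real (card K)"
  shows "q\<^sup>2 * (7 * (62 - L) / 16 + 49 / 24) \<le> 7 * (\<Sum>y\<in>K. 3 + real (card (N y \<inter> K)))"
proof (rule half_ineq[OF _ _ K _ b _ L _ q])
  show sub: "W \<subseteq> N x" by (auto simp: W rest_def)
  show "card W = 30" unfolding W by (rule card_rest[OF p])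
  show "card (nonnbrs W w) = 2" if "w \<in> W" "nonnbrs W w \<noteq> {}" for w
    using rest_nonnbrs_le2[OF p] that unfolding W by blast
  show "E y0 u \<longleftrightarrow> \<not> E y0 w" if "w \<in> W" "u \<in> nonnbrs W w" for u w
    using alt that by (auto simp: alternates_def)
  have "a \<in> {w \<in> W. nonnbrs W w \<noteq> {}}"
    using pent_rest[OF p] unfolding W by blast
  moreover have "finite W" using sub finN finite_subset by blast
  ultimately show "L > 0" unfolding L by (auto simp: card_gt_0_iff)
qed

text \<open>\<open>pent_half\<close> with a single alternating vertex gives L \<ge> 56/3. Such a
  vertex exists since 26 candidates outnumber 4 exceptions.\<close>

lemma pent_many_nonnbrs:
  assumes p: "pent x a b c R"
  shows "19 \<le> card {w \<in> rest x (insert c R). nonnbrs (rest x (insert c R)) w \<noteq> {}}"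
proof -
  define W where "W = rest x (insert c R)"
  obtain X where X: "finite X" "card X \<le> 4"
    "\<And>y. y \<in> N a \<inter> N c \<inter> N x - X \<Longrightarrow> alternates y W"
    using pent_alternates[OF p] unfolding W_def by blast
  have "card (N a \<inter> N c \<inter> N x) = 26"
    by (rule local_coclique_5_counts(2)[OF pent_counts[OF p]]) (use p in \<open>auto simp: pent_def\<close>)
  then have "\<not> N a \<inter> N c \<inter> N x \<subseteq> X"
    using card_mono[OF X(1), of "N a \<inter> N c \<inter> N x"] X(2) by auto
  then obtain y where y: "y \<in> N a \<inter> N c \<inter> N x - X" by blast
  define L where "L = real (card {w \<in> W. nonnbrs W w \<noteq> {}})"
  have "1\<^sup>2 * (7 * (62 - L) / 16 + 49 / 24) \<le> 7 * (\<Sum>z\<in>{y}. 3 + real (card (N z \<inter> {y})))"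
    by (rule pent_half[OF p W_def _ _ _ X(3)[OF y] L_def])
      (use y in \<open>auto simp: W_def rest_def E_commute\<close>)
  moreover have "N y \<inter> {y} = {}" using irrefl by auto
  ultimately have "7 * (62 - L) / 16 + 49 / 24 \<le> 21" by simp
  then show ?thesis unfolding W_def[symmetric] L_def by (simp add: field_simps)
qed

text \<open>Two alternating vertices with a common non-neighbour \<open>v\<close> among the common
  neighbours of \<open>a\<close> and \<open>c\<close> have the same neighbours in \<open>W\<close>,
  which violates \<open>pent_half\<close> for a set of size 2.\<close>

lemma not_pent: "\<not> pent x a b c R"
proof
  assume p: "pent x a b c R"
  then have p': "pent x a c b R" by (rule pent_swap23)
  define W where "W = rest x (insert c R)"
  define W' where "W' = rest x (insert b R)"
  obtain X where X: "finite X" "card X \<le> 4"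
    "\<And>y. y \<in> N a \<inter> N c \<inter> N x - X \<Longrightarrow> alternates y W"
    using pent_alternates[OF p] unfolding W_def by blast
  obtain p1 where p1: "priv x (pset a c b R) a = {p1}"
    using pent_priv[OF p', of a] by auto
  obtain p2 where p2: "priv x (pset a c b R) c = {p2}"
    using pent_priv[OF p', of c] by auto
  have nna: "nonnbrs W' a = {c, p2}"
    using rest_nonnbrs(1)[OF p'] p2 by (simp add: W'_def)
  have nnc: "nonnbrs W' c = {a, p1}"
    using rest_nonnbrs(1)[OF pent_swap12[OF p']] p1 by (simp add: W'_def insert_commute)
  have W': "W' = {a, c, p1, p2} \<union> (N a \<inter> N c \<inter> N x)"
    unfolding W'_def rest_eq[OF p'] p1 p2 by auto
  have le2: "finite (nonnbrs W' w) \<and> card (nonnbrs W' w) \<le> 2" if "w \<in> W'" for w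
    using rest_nonnbrs_le2[OF p', of w] that unfolding W'_def[symmetric]
    by (auto intro: card_ge_0_finite)
  \<comment> \<open>Outside \<open>Y\<close>, \<open>v\<close> is a common neighbour of
    \<open>a\<close> and \<open>c\<close>, and so are its non-neighbours in \<open>W'\<close>, which
    moreover avoid \<open>X\<close>. The size is at most 4 + 2 + 2 + 4 * 2 = 16, below 19.\<close>
  define Y where "Y = {a, c, p1, p2} \<union> nonnbrs W' p1 \<union> nonnbrs W' p2 \<union> (\<Union>z\<in>X \<inter> W'. nonnbrs W' z)"
  have "card Y \<le> card {a, c, p1, p2} + card (nonnbrs W' p1) + card (nonnbrs W' p2) + card (\<Union>z\<in>X \<inter> W'. nonnbrs W' z)"
    unfolding Y_def by (meson card_Un_le add_mono order_trans order_refl)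
  moreover have "card {a, c, p1, p2} \<le> 4"
    using card_length[of "[a, c, p1, p2]"] by simp
  moreover have "card (nonnbrs W' p1) \<le> 2" "card (nonnbrs W' p2) \<le> 2"
    using le2 W' by auto
  moreover have "card (\<Union>z\<in>X \<inter> W'. nonnbrs W' z) \<le> 8"
  proof -
    have "card (\<Union>z\<in>X \<inter> W'. nonnbrs W' z) \<le> (\<Sum>z\<in>X \<inter> W'. card (nonnbrs W' z))"
      using X(1) by (intro card_UN_le) auto
    also have "\<dots> \<le> (\<Sum>z\<in>X \<inter> W'. 2)"
      by (rule sum_mono) (use le2 in auto)
    also have "\<dots> \<le> 8"
      using card_mono[OF X(1), of "X \<inter> W'"] X(2) by simp
    finally show ?thesis .
  qed
  ultimately have "card Y \<le> 16" by linarith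
  moreover have "finite Y" using X(1) le2 W' by (auto simp: Y_def)
  moreover have "19 \<le> card {w \<in> W'. nonnbrs W' w \<noteq> {}}"
    using pent_many_nonnbrs[OF p'] by (simp add: W'_def)
  ultimately have "\<not> {w \<in> W'. nonnbrs W' w \<noteq> {}} \<subseteq> Y"
    using card_mono[of Y "{w \<in> W'. nonnbrs W' w \<noteq> {}}"] by linarith
  then obtain v where v: "v \<in> W'" "nonnbrs W' v \<noteq> {}" "v \<notin> Y" by blast
  have "card (nonnbrs W' v) = 2"
    using rest_nonnbrs_le2[OF p', of v] v unfolding W'_def[symmetric] by blast
  then obtain y1 y2 where y12: "nonnbrs W' v = {y1, y2}" "y1 \<noteq> y2" by (auto simp: card_2_iff)
  have vV: "v \<in> N a \<inter> N c \<inter> N x" using v W' by (auto simp: Y_def)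
  have yV: "y \<in> N a \<inter> N c \<inter> N x - X" and yv: "y \<noteq> v" "\<not> E y v" if y: "y \<in> {y1, y2}" for y
  proof -
    have ynn: "y \<in> nonnbrs W' v" using y y12 by simp
    then have yW: "y \<in> W'" and ynv: "v \<in> nonnbrs W' y"
      using nonnbrs_sym[of y W' v] v(1) by (auto simp: nonnbrs_def)
    show "y \<noteq> v" "\<not> E y v" using ynv by (auto simp: nonnbrs_def)
    have "y \<notin> {a, c, p1, p2}"
    proof
      assume "y \<in> {a, c, p1, p2}"
      then have "v \<in> Y" using ynv nna nnc by (auto simp: Y_def)
      then show False using v by simp
    qed
    moreover have "y \<notin> X"
    proof
      assume "y \<in> X"
      then have "v \<in> Y" using ynv yW by (auto simp: Y_def)
      then show False using v by simp
    qed
    ultimately show "y \<in> N a \<inter> N c \<inter> N x - X" using yW W' by blast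
  qed
  \<comment> \<open>The right side depends on \<open>v\<close> but not on \<open>y\<close>. Inside
    the common neighbourhood of \<open>a\<close> and \<open>b\<close> this is
    \<open>pent_inner\<close> with \<open>b\<close> and \<open>c\<close> exchanged; elsewhere
    alternation decides, as \<open>y\<close> sees \<open>a\<close> and not \<open>b\<close>.\<close>
  have adj: "E y w \<longleftrightarrow> w = a \<or> w \<in> nonnbrs W b \<or> (w \<in> N a \<inter> N b \<inter> N x \<and> \<not> E v w)"
    if y: "y \<in> {y1, y2}" and w: "w \<in> W" for y w
  proof -
    have yV': "y \<in> N a \<inter> N c \<inter> N x" using yV[OF y] by blast
    have ya: "E y a" using yV' by (simp add: E_commute)
    have yb: "\<not> E y b" by (rule pent_common_other(1)[OF p yV'])
    have alt: "E y u \<longleftrightarrow> \<not> E y w'" if "w' \<in> W" "u \<in> nonnbrs W w'" for u w'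
      using X(3)[OF yV[OF y]] that by (auto simp: alternates_def)
    have aW: "a \<in> W" and bW: "b \<in> W" using pent_rest[OF p] by (auto simp: W_def)
    have nnV: "w \<notin> nonnbrs W b \<and> w \<noteq> a" if "w \<in> N a \<inter> N b \<inter> N x"
      using that irrefl by (auto simp: nonnbrs_def)
    have "w \<in> {a, b} \<union> (N a \<inter> N b \<inter> N x) \<union> nonnbrs W a \<union> nonnbrs W b"
      using w rest_eq[OF p] rest_nonnbrs(1)[OF p] rest_nonnbrs(1)[OF pent_swap12[OF p]]
      by (auto simp: W_def insert_commute)
    then consider "w = a" | "w = b" | "w \<in> N a \<inter> N b \<inter> N x" | "w \<in> nonnbrs W a" "w \<noteq> b" | "w \<in> nonnbrs W b"
      by blast
    then show ?thesis
    proof cases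
      case 1
      then show ?thesis using ya by simp
    next
      case 2
      then show ?thesis using yb p irrefl by (auto simp: nonnbrs_def pent_def)
    next
      case 3
      have "E w y \<longleftrightarrow> \<not> E w v"
        by (rule pent_inner[OF p' yV' vV yv[OF y] 3])
      then show ?thesis using nnV[OF 3] 3 by (auto simp: E_commute)
    next
      case 4
      then have "\<not> E y w" using alt[OF aW 4(1)] ya by simp
      moreover have "\<not> E a w" "w \<noteq> a" using 4 by (auto simp: nonnbrs_def)
      moreover have "w \<notin> nonnbrs W b" using alt[OF bW, of w] yb \<open>\<not> E y w\<close> by blast
      ultimately show ?thesis by simp
    next
      case 5
      then show ?thesis using alt[OF bW 5] yb by simp
    qed
  qed
  define L where "L = real (card {w \<in> W. nonnbrs W w \<noteq> {}})"
  have fW: "finite W" by (rule finite_subset[OF _ finN[of x]]) (auto simp: W_def rest_def)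
  have "card {w \<in> W. nonnbrs W w \<noteq> {}} \<le> card W" by (rule card_mono[OF fW]) auto
  then have L30: "L \<le> 30" using card_rest[OF p] by (simp add: L_def W_def)
  \<comment> \<open>For L \<le> 30 the left side exceeds 64. The right side is at most 7 * (4 + 4) =
    56, even if \<open>y1\<close> and \<open>y2\<close> are adjacent.\<close>
  have "(2::real)\<^sup>2 * (7 * (62 - L) / 16 + 49 / 24) \<le> 7 * (\<Sum>y\<in>{y1, y2}. 3 + real (card (N y \<inter> {y1, y2})))"
  proof (rule pent_half[OF p W_def _ _ _ X(3)[of y1] L_def])
    show "{y1, y2} \<subseteq> N x" "{y1, y2} \<inter> W = {}" "y1 \<in> N a \<inter> N c \<inter> N x - X"
      using yV[of y1] yV[of y2] by (auto simp: W_def rest_def E_commute)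
    show "E y w \<longleftrightarrow> E y1 w" if "y \<in> {y1, y2}" "w \<in> W" for y w
      using adj[OF that] adj[of y1 w] that(2) by simp
    show "2 = real (card {y1, y2})" using y12 by simp
  qed
  also have "\<dots> \<le> 7 * (\<Sum>y\<in>{y1, y2}. 4)"
  proof -
    have "card (N y \<inter> {y1, y2}) \<le> 1" if "y \<in> {y1, y2}" for y
    proof -
      have "card (N y \<inter> {y1, y2}) \<le> card ({y1, y2} - {y})"
        using irrefl by (intro card_mono) auto
      then show ?thesis using that y12(2) by auto
    qed
    then have "(\<Sum>y\<in>{y1, y2}. 3 + real (card (N y \<inter> {y1, y2}))) \<le> (\<Sum>y\<in>{y1, y2}. 4)"
      by (intro sum_mono) auto
    then show ?thesis by simp
  qed
  finally show False using L30 y12 by (simp add: field_simps)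
qed

lemma no_srg1911: False
proof -
  have "V \<noteq> {}" using cardV by auto
  then obtain x where "x \<in> V" by blast
  then obtain K where K: "local_coclique x K" "card K = 5" using ex_local_coclique_5 by blast
  obtain a K4 where 4: "K = insert a K4" "a \<notin> K4" "card K4 = 4" "finite K4"
    using K(2) card_Suc_eq_finite[of K 4] by auto
  obtain b K3 where 3: "K4 = insert b K3" "b \<notin> K3" "card K3 = 3" "finite K3"
    using 4(3) card_Suc_eq_finite[of K4 3] by auto
  obtain c R where 2: "K3 = insert c R" "c \<notin> R" "card R = 2" "finite R"
    using 3(3) card_Suc_eq_finite[of K3 2] by auto
  have "pent x a b c R"
    using K 4 3 2 by (auto simp: pent_def)
  then show False using not_pent by blast
qed

end

section \<open>Transfer to strongly regular pair graphs\<close>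

theorem theorem1p1:
  shows "\<not> (\<exists>G :: 'a pair_pre_digraph. strongly_regular_graph G 1911 270 105 27)"
proof
  assume "\<exists>G :: 'a pair_pre_digraph. strongly_regular_graph G 1911 270 105 27"
  then obtain G :: "'a pair_pre_digraph" where "strongly_regular_graph G 1911 270 105 27" ..
  then interpret strongly_regular_graph G 1911 270 105 27 .
  have arcV: "u \<in> pverts G \<and> v \<in> pverts G" if "(u, v) \<in> parcs G" for u v
    using that in_arcsD1 in_arcsD2 by blast
  have nb: "common_neighbours G u v = {w. (u, w) \<in> parcs G} \<inter> {w. (v, w) \<in> parcs G}" for u v
    using arcV by (auto simp: common_neighbours_def)
  have out: "out_degree (with_proj G) v = card {w. (v, w) \<in> parcs G}" for v
  proof -
    have "out_arcs (with_proj G) v = Pair v ` {w. (v, w) \<in> parcs G}"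
      by (auto simp: out_arcs_def)
    then show ?thesis by (simp add: out_degree_def card_image inj_on_def)
  qed
  interpret srg1911 "pverts G" "\<lambda>u v. (u, v) \<in> parcs G"
  proof
    show "finite (pverts G)" by (rule pair_finite_verts)
    show "card (pverts G) = 1911" by (rule card_verts)
    show "(v, u) \<in> parcs G" if "(u, v) \<in> parcs G" for u v
      using that by (rule arcs_symmetric)
    show "(u, u) \<notin> parcs G" for u
      using pair_no_loops[of "(u, u)"] by auto
    show "v \<in> pverts G" if "(u, v) \<in> parcs G" for u v
      using arcV[OF that] by blast
    show "card {w. (v, w) \<in> parcs G} = 270" if "v \<in> pverts G" for v
      using regular[OF that] out by simp
    show "card ({w. (u, w) \<in> parcs G} \<inter> {w. (v, w) \<in> parcs G}) = 105" if "(u, v) \<in> parcs G" for u v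
      using adjacent[of u v] arcV[OF that] that pair_no_loops[OF that] unfolding nb by auto
    show "card ({w. (u, w) \<in> parcs G} \<inter> {w. (v, w) \<in> parcs G}) = 27"
      if "u \<in> pverts G" "v \<in> pverts G" "u \<noteq> v" "(u, v) \<notin> parcs G" for u v
      using non_adjacent[OF that] unfolding nb by simp
  qed
  show False by (rule no_srg1911)
qed

end
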